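(* Let $\mathbf{P}\colon\mathsf{C}^{\mathrm{op}}\to\mathsf{BA}$ be a Boolean doctrine with $\mathsf{C}$ small, and let $I=(I_X)_{X\in\mathsf{C}}$ be a family with $I_X\subseteq\mathbf{P}(X)$. The following are equivalent: (1) there is a class $\mathcal{M}$ of propositional models of $\mathbf{P}$ such that for every $X\in\mathsf{C}$, $I_X=\{\alpha\in\mathbf{P}(X)\mid\text{for all }(M,\mathfrak{m})\in\mathcal{M},\text{ not all }x\in M(X)\text{ satisfy }x\in\mathfrak{m}_X(\alpha)\}$; (2) $I$ is a universal ideal for $\mathbf{P}$; (3) $I$ is the (componentwise) intersection of the universal ultraideals for $\mathbf{P}$ containing $I$. Moreover, the following are also equivalent: (1') statement (1) with $\mathcal{M}$ nonempty; (2') $I$ is a consistent universal ideal; (3') statement (3) holds and there exists a universal ultraideal for $\mathbf{P}$ containing $I$.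
   Context: Categories have finite products; $\mathbf{t}$ terminal, $\mathrm{pr}_i$ projections. A Boolean doctrine is a functor $\mathbf{P}\colon\mathsf{C}^{\mathrm{op}}\to\mathsf{BA}$. A propositional model of $\mathbf{P}$ is a pair $(M,\mathfrak{m})$ with $M\colon\mathsf{C}\to\mathsf{Set}$ finite-product-preserving and $\mathfrak{m}\colon\mathbf{P}\Rightarrow\mathscr{P}\circ M^{\mathrm{op}}$ natural, $\mathscr{P}$ being the power set functor with preimage maps. A universal ideal for $\mathbf{P}$ is a family $(I_X)$, $I_X\subseteq\mathbf{P}(X)$, such that: (i) for all $m\in\mathbb{N}$, $f_1,\dots,f_m\colon X\to Y$, $\alpha\in\mathbf{P}(Y)$, if $\bigwedge_{j=1}^m\mathbf{P}(f_j)(\alpha)\in I_X$ then $\alpha\in I_Y$; (ii) each $I_X$ is downward closed; (iii) $\alpha_1\in I_{X_1}$, $\alpha_2\in I_{X_2}$ imply $\mathbf{P}(\mathrm{pr}_1)(\alpha_1)\lor\mathbf{P}(\mathrm{pr}_2)(\alpha_2)\in I_{X_1\times X_2}$; (iv) $\bot_{\mathbf{P}(\mathbf{t})}\in I_{\mathbf{t}}$. It is consistent if $\top_{\mathbf{P}(\mathbf{t})}\notin I_{\mathbf{t}}$. A universal ultraideal for $\mathbf{P}$ is a family $(J_X)$, $J_X\subseteq\mathbf{P}(X)$, such that: for all $f\colon X\to Y$ and $\alpha\in\mathbf{P}(Y)$, $\mathbf{P}(f)(\alpha)\in J_X$ implies $\alpha\in J_Y$; each $\mathbf{P}(X)\setminus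 J_X$ is a filter; condition (iii) above holds; and $\bot_{\mathbf{P}(\mathbf{t})}\in J_{\mathbf{t}}$. The intersection of an empty family is understood componentwise as $\mathbf{P}(X)$. *)

theory Defs
  imports "HOL-Algebra.Complete_Lattice" "HOL-Library.Equipollence" "HOL-Library.FuncSet"
begin

section \<open>Categories with finite products\<close>

text \<open>Finite products are given by a chosen terminal object and chosen binary products
  with their projections. Composition is in applicative order: \<open>Comp C g f\<close> is \<open>g\<close> after \<open>f\<close>.\<close>

record ('o, 'a) fpcat =
  Obj :: "'o set"
  Arr :: "'a set"
  Dom :: "'a \<Rightarrow> 'o"
  Cod :: "'a \<Rightarrow> 'o"
  Id :: "'o \<Rightarrow> 'a"
  Comp :: "'a \<Rightarrow> 'a \<Rightarrow> 'a"
  Trm :: "'o"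
  Prd :: "'o \<Rightarrow> 'o \<Rightarrow> 'o"
  Pr1 :: "'o \<Rightarrow> 'o \<Rightarrow> 'a"
  Pr2 :: "'o \<Rightarrow> 'o \<Rightarrow> 'a"

definition Homs :: "('o, 'a) fpcat \<Rightarrow> 'o \<Rightarrow> 'o \<Rightarrow> 'a set" where
  "Homs C X Y = {f \<in> Arr C. Dom C f = X \<and> Cod C f = Y}"

definition is_category :: "('o, 'a) fpcat \<Rightarrow> bool" where
  "is_category C \<longleftrightarrow>
     Dom C \<in> Arr C \<rightarrow> Obj C \<and> Cod C \<in> Arr C \<rightarrow> Obj C \<and>
     (\<forall>X\<in>Obj C. Id C X \<in> Homs C X X) \<and>
     (\<forall>X\<in>Obj C. \<forall>Y\<in>Obj C. \<forall>Z\<in>Obj C. \<forall>f\<in>Homs C X Y. \<forall>g\<in>Homs C Y Z.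
        Comp C g f \<in> Homs C X Z) \<and>
     (\<forall>X\<in>Obj C. \<forall>Y\<in>Obj C. \<forall>f\<in>Homs C X Y. Comp C f (Id C X) = f \<and> Comp C (Id C Y) f = f) \<and>
     (\<forall>W\<in>Obj C. \<forall>X\<in>Obj C. \<forall>Y\<in>Obj C. \<forall>Z\<in>Obj C.
        \<forall>f\<in>Homs C W X. \<forall>g\<in>Homs C X Y. \<forall>h\<in>Homs C Y Z.
        Comp C h (Comp C g f) = Comp C (Comp C h g) f)"

definition is_terminal :: "('o, 'a) fpcat \<Rightarrow> 'o \<Rightarrow> bool" where
  "is_terminal C T \<longleftrightarrow> T \<in> Obj C \<and> (\<forall>X\<in>Obj C. \<exists>!f. f \<in> Homs C X T)"

definition is_product :: "('o, 'a) fpcat \<Rightarrow> 'o \<Rightarrow> 'o \<Rightarrow> 'o \<Rightarrow> 'a \<Rightarrow> 'a \<Rightarrow> bool" where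
  "is_product C X Y Z p q \<longleftrightarrow>
     X \<in> Obj C \<and> Y \<in> Obj C \<and> Z \<in> Obj C \<and> p \<in> Homs C Z X \<and> q \<in> Homs C Z Y \<and>
     (\<forall>W\<in>Obj C. \<forall>f\<in>Homs C W X. \<forall>g\<in>Homs C W Y.
        \<exists>!h. h \<in> Homs C W Z \<and> Comp C p h = f \<and> Comp C q h = g)"

definition fp_category :: "('o, 'a) fpcat \<Rightarrow> bool" where
  "fp_category C \<longleftrightarrow>
     is_category C \<and> is_terminal C (Trm C) \<and>
     (\<forall>X\<in>Obj C. \<forall>Y\<in>Obj C. is_product C X Y (Prd C X Y) (Pr1 C X Y) (Pr2 C X Y))"

section \<open>Boolean algebras\<close>

locale boolean_lattice = bounded_lattice L for L (structure) +
  assumes meet_join_distrib: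
    "\<lbrakk>x \<in> carrier L; y \<in> carrier L; z \<in> carrier L\<rbrakk>
      \<Longrightarrow> x \<sqinter> (y \<squnion> z) = (x \<sqinter> y) \<squnion> (x \<sqinter> z)"
  and complement_exists:
    "x \<in> carrier L \<Longrightarrow> \<exists>y\<in>carrier L. x \<sqinter> y = \<bottom> \<and> x \<squnion> y = \<top>"

text \<open>Complements in a Boolean algebra are unique, so they are preserved automatically.\<close>

definition boolean_hom :: "'p gorder \<Rightarrow> 'q gorder \<Rightarrow> ('p \<Rightarrow> 'q) \<Rightarrow> bool" where
  "boolean_hom A B h \<longleftrightarrow>
     h \<in> carrier A \<rightarrow> carrier B \<and> meet_pres A B h \<and> join_pres A B h \<and>
     h \<top>\<^bsub>A\<^esub> = \<top>\<^bsub>B\<^esub> \<and> h \<bottom>\<^bsub>A\<^esub> = \<bottom>\<^bsub>B\<^esub>"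

definition powerset_lattice :: "'u set \<Rightarrow> 'u set gorder" where
  "powerset_lattice A = \<lparr>carrier = Pow A, eq = (=), le = (\<subseteq>)\<rparr>"

text \<open>A filter is not required to be proper.\<close>

definition lattice_filter :: "'p gorder \<Rightarrow> 'p set \<Rightarrow> bool" where
  "lattice_filter L F \<longleftrightarrow>
     F \<subseteq> carrier L \<and> \<top>\<^bsub>L\<^esub> \<in> F \<and>
     (\<forall>x\<in>F. \<forall>y\<in>carrier L. x \<sqsubseteq>\<^bsub>L\<^esub> y \<longrightarrow> y \<in> F) \<and>
     (\<forall>x\<in>F. \<forall>y\<in>F. x \<sqinter>\<^bsub>L\<^esub> y \<in> F)"

section \<open>Boolean doctrines and propositional models\<close>

record ('o, 'a, 'p) doctrine =
  Fib :: "'o \<Rightarrow> 'p gorder"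
  Reidx :: "'a \<Rightarrow> 'p \<Rightarrow> 'p"

definition boolean_doctrine :: "('o, 'a) fpcat \<Rightarrow> ('o, 'a, 'p) doctrine \<Rightarrow> bool" where
  "boolean_doctrine C P \<longleftrightarrow>
     fp_category C \<and>
     (\<forall>X\<in>Obj C. boolean_lattice (Fib P X)) \<and>
     (\<forall>X\<in>Obj C. \<forall>Y\<in>Obj C. \<forall>f\<in>Homs C X Y. boolean_hom (Fib P Y) (Fib P X) (Reidx P f)) \<and>
     (\<forall>X\<in>Obj C. \<forall>\<alpha>\<in>carrier (Fib P X). Reidx P (Id C X) \<alpha> = \<alpha>) \<and>
     (\<forall>X\<in>Obj C. \<forall>Y\<in>Obj C. \<forall>Z\<in>Obj C. \<forall>f\<in>Homs C X Y. \<forall>g\<in>Homs C Y Z. \<forall>\<alpha>\<in>carrier (Fib P Z).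
        Reidx P (Comp C g f) \<alpha> = Reidx P f (Reidx P g \<alpha>))"

text \<open>The sets in the image of a functor to sets are subsets of a type \<open>'u\<close>, which plays the role
  of the universe. Smallness of categories and Boolean algebras is relative to it: \<open>'u\<close> is infinite
  and the sets of arrows and the fibres inject into it. \<open>Pts\<close> and \<open>Act\<close> are the object and arrow parts of the functor, \<open>Sat\<close> is
  the natural transformation.\<close>

record ('o, 'a, 'p, 'u) model =
  Pts :: "'o \<Rightarrow> 'u set"
  Act :: "'a \<Rightarrow> 'u \<Rightarrow> 'u"
  Sat :: "'o \<Rightarrow> 'p \<Rightarrow> 'u set"

definition set_functor :: "('o, 'a) fpcat \<Rightarrow> ('o \<Rightarrow> 'u set) \<Rightarrow> ('a \<Rightarrow> 'u \<Rightarrow> 'u) \<Rightarrow> bool" where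
  "set_functor C S T \<longleftrightarrow>
     (\<forall>X\<in>Obj C. \<forall>Y\<in>Obj C. \<forall>f\<in>Homs C X Y. T f \<in> S X \<rightarrow> S Y) \<and>
     (\<forall>X\<in>Obj C. \<forall>x\<in>S X. T (Id C X) x = x) \<and>
     (\<forall>X\<in>Obj C. \<forall>Y\<in>Obj C. \<forall>Z\<in>Obj C. \<forall>f\<in>Homs C X Y. \<forall>g\<in>Homs C Y Z. \<forall>x\<in>S X.
        T (Comp C g f) x = T g (T f x))"

definition preserves_finite_products ::
  "('o, 'a) fpcat \<Rightarrow> ('o \<Rightarrow> 'u set) \<Rightarrow> ('a \<Rightarrow> 'u \<Rightarrow> 'u) \<Rightarrow> bool" where
  "preserves_finite_products C S T \<longleftrightarrow>
     (\<forall>Z. is_terminal C Z \<longrightarrow> (\<exists>!z. z \<in> S Z)) \<and>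
     (\<forall>X Y Z p q. is_product C X Y Z p q \<longrightarrow> bij_betw (\<lambda>z. (T p z, T q z)) (S Z) (S X \<times> S Y))"

definition propositional_model ::
  "('o, 'a) fpcat \<Rightarrow> ('o, 'a, 'p) doctrine \<Rightarrow> ('o, 'a, 'p, 'u) model \<Rightarrow> bool" where
  "propositional_model C P M \<longleftrightarrow>
     set_functor C (Pts M) (Act M) \<and>
     preserves_finite_products C (Pts M) (Act M) \<and>
     (\<forall>X\<in>Obj C. boolean_hom (Fib P X) (powerset_lattice (Pts M X)) (Sat M X)) \<and>
     (\<forall>X\<in>Obj C. \<forall>Y\<in>Obj C. \<forall>f\<in>Homs C X Y. \<forall>\<alpha>\<in>carrier (Fib P Y).
        Sat M X (Reidx P f \<alpha>) = {x \<in> Pts M X. Act M f x \<in> Sat M Y \<alpha>})"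

section \<open>Universal ideals and universal ultraideals\<close>

definition join_closed_over_products ::
  "('o, 'a) fpcat \<Rightarrow> ('o, 'a, 'p) doctrine \<Rightarrow> ('o \<Rightarrow> 'p set) \<Rightarrow> bool" where
  "join_closed_over_products C P I \<longleftrightarrow>
     (\<forall>X1\<in>Obj C. \<forall>X2\<in>Obj C. \<forall>\<alpha>1\<in>I X1. \<forall>\<alpha>2\<in>I X2.
        Reidx P (Pr1 C X1 X2) \<alpha>1 \<squnion>\<^bsub>Fib P (Prd C X1 X2)\<^esub> Reidx P (Pr2 C X1 X2) \<alpha>2
          \<in> I (Prd C X1 X2))"

text \<open>In the first clause the list \<open>fs\<close> may be empty; the infimum is then the top element.\<close>

definition universal_ideal ::
  "('o, 'a) fpcat \<Rightarrow> ('o, 'a, 'p) doctrine \<Rightarrow> ('o \<Rightarrow> 'p set) \<Rightarrow> bool" where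
  "universal_ideal C P I \<longleftrightarrow>
     (\<forall>X\<in>Obj C. I X \<subseteq> carrier (Fib P X)) \<and>
     (\<forall>X\<in>Obj C. \<forall>Y\<in>Obj C. \<forall>fs. \<forall>\<alpha>\<in>carrier (Fib P Y).
        set fs \<subseteq> Homs C X Y \<longrightarrow> \<Sqinter>\<^bsub>Fib P X\<^esub>((\<lambda>f. Reidx P f \<alpha>) ` set fs) \<in> I X \<longrightarrow> \<alpha> \<in> I Y) \<and>
     (\<forall>X\<in>Obj C. \<forall>\<alpha>\<in>I X. \<forall>\<beta>\<in>carrier (Fib P X). \<beta> \<sqsubseteq>\<^bsub>Fib P X\<^esub> \<alpha> \<longrightarrow> \<beta> \<in> I X) \<and>
     join_closed_over_products C P I \<and>
     \<bottom>\<^bsub>Fib P (Trm C)\<^esub> \<in> I (Trm C)"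

definition consistent ::
  "('o, 'a) fpcat \<Rightarrow> ('o, 'a, 'p) doctrine \<Rightarrow> ('o \<Rightarrow> 'p set) \<Rightarrow> bool" where
  "consistent C P I \<longleftrightarrow> \<top>\<^bsub>Fib P (Trm C)\<^esub> \<notin> I (Trm C)"

definition universal_ultraideal ::
  "('o, 'a) fpcat \<Rightarrow> ('o, 'a, 'p) doctrine \<Rightarrow> ('o \<Rightarrow> 'p set) \<Rightarrow> bool" where
  "universal_ultraideal C P J \<longleftrightarrow>
     (\<forall>X\<in>Obj C. J X \<subseteq> carrier (Fib P X)) \<and>
     (\<forall>X\<in>Obj C. \<forall>Y\<in>Obj C. \<forall>f\<in>Homs C X Y. \<forall>\<alpha>\<in>carrier (Fib P Y).
        Reidx P f \<alpha> \<in> J X \<longrightarrow> \<alpha> \<in> J Y) \<and>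
     (\<forall>X\<in>Obj C. lattice_filter (Fib P X) (carrier (Fib P X) - J X)) \<and>
     join_closed_over_products C P J \<and>
     \<bottom>\<^bsub>Fib P (Trm C)\<^esub> \<in> J (Trm C)"

definition ultraideals_above ::
  "('o, 'a) fpcat \<Rightarrow> ('o, 'a, 'p) doctrine \<Rightarrow> ('o \<Rightarrow> 'p set) \<Rightarrow> ('o \<Rightarrow> 'p set) set" where
  "ultraideals_above C P I = {J. universal_ultraideal C P J \<and> (\<forall>X\<in>Obj C. I X \<subseteq> J X)}"

text \<open>The ideal of formulas whose universal closure fails in all models of a class. Models are
  not required to have nonempty carriers.\<close>

definition ideal_of_models ::
  "('o, 'a, 'p) doctrine \<Rightarrow> ('o, 'a, 'p, 'u) model set \<Rightarrow> 'o \<Rightarrow> 'p set" where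
  "ideal_of_models P \<M> X =
     {\<alpha> \<in> carrier (Fib P X). \<forall>M\<in>\<M>. \<not> (\<forall>x\<in>Pts M X. x \<in> Sat M X \<alpha>)}"

end

theory Submission
  imports Defs
begin

text \<open>
  The core is a completeness statement: if \<open>I\<close> is a universal ideal and \<open>\<alpha> \<notin> I X\<close>, then some
  propositional model validates \<open>\<alpha>\<close> at all points of sort \<open>X\<close> and refutes every \<open>\<beta> \<in> I Y\<close> at some
  point. Such a model is built by a Henkin construction. Adjoin a constant of sort \<open>Y\<close> for every
  \<open>\<beta> \<in> I Y\<close>; a finite list of constants has a product of objects as context, and the points of
  sort \<open>Z\<close> are the arrows from contexts to \<open>Z\<close>, identified when they agree on a larger context.
  A colimit of representables along contexts, this functor preserves finite products. In the
  colimit of the fibres over the contexts, the filter generated by all instances of \<open>\<alpha>\<close> is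
  disjoint from the ideal generated by the formulas \<open>\<beta>\<close> at their constants: otherwise a finite
  meet of instances of \<open>\<alpha>\<close> would lie below a join of such \<open>\<beta>\<close> over a product, hence in \<open>I\<close>, and
  \<open>\<alpha>\<close> would be in \<open>I X\<close>. A filter that is maximal among those disjoint from the ideal is prime
  and defines the satisfaction relation. The formulas not valid in one model form a universal
  ultraideal, so the model also yields the representation by ultraideals; conversely universal
  ideals are closed under intersections and contain the universal ultraideals as special cases.
\<close>

section \<open>Cardinality\<close>

text \<open>A list is coded by its length together with its entries, folded into one element by an
  injective pairing on the infinite universe.\<close>

lemma lists_lepoll_infinite:
  assumes inf: "infinite (UNIV :: 'u set)" and A: "A \<lesssim> (UNIV :: 'u set)"
  shows "lists A \<lesssim> (UNIV :: 'u set)"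
proof -
  obtain j :: "'a \<Rightarrow> 'u" where j: "inj_on j A"
    using A by (auto simp: lepoll_def)
  obtain n :: "nat \<Rightarrow> 'u" where n: "inj n"
    using inf infinite_le_lepoll[of "UNIV :: 'u set"] by (auto simp: lepoll_def)
  obtain p :: "'u \<times> 'u \<Rightarrow> 'u" where p: "inj p"
    using card_of_Times_same_infinite[OF inf] by (auto simp: card_of_ordIso[symmetric] bij_betw_def)
  \<comment> \<open>\<open>n 0\<close> is arbitrary padding at the end of the list. Lists of
    different lengths may fold to the same value, which is why the length is coded
    separately.\<close>
  let ?e = "\<lambda>xs. foldr (\<lambda>x r. p (j x, r)) xs (n 0)"
  have e: "xs = ys" if "length xs = length ys" "xs \<in> lists A" "ys \<in> lists A" "?e xs = ?e ys" for xs ys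
    using that
  proof (induction rule: list_induct2)
    case (Cons x xs y ys)
    then have "j x = j y" "?e xs = ?e ys"
      by (auto dest: injD[OF p])
    then show ?case
      using Cons inj_onD[OF j] by (metis Cons_in_lists_iff)
  qed simp
  have "inj_on (\<lambda>xs. p (n (length xs), ?e xs)) (lists A)"
    by (intro inj_onI e) (auto dest!: injD[OF p] injD[OF n])
  then show ?thesis
    by (auto simp: lepoll_def)
qed

lemma Times_lepoll_infinite:
  assumes inf: "infinite (UNIV :: 'u set)" and "A \<lesssim> (UNIV :: 'u set)" "B \<lesssim> (UNIV :: 'u set)"
  shows "A \<times> B \<lesssim> (UNIV :: 'u set)"
proof -
  obtain p :: "'u \<times> 'u \<Rightarrow> 'u" where "inj p"
    using card_of_Times_same_infinite[OF inf] by (auto simp: card_of_ordIso[symmetric] bij_betw_def)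
  then have "(UNIV :: 'u set) \<times> (UNIV :: 'u set) \<lesssim> (UNIV :: 'u set)"
    unfolding lepoll_def by (intro exI[of _ p]) simp
  then show ?thesis
    using assms times_lepoll_mono lepoll_trans by blast
qed

lemma Sigma_lepoll_Times:
  assumes "\<And>x. x \<in> A \<Longrightarrow> B x \<lesssim> U"
  shows "Sigma A B \<lesssim> A \<times> U"
proof -
  obtain j where j: "\<And>x. x \<in> A \<Longrightarrow> inj_on (j x) (B x) \<and> j x ` B x \<subseteq> U"
    using assms unfolding lepoll_def by metis
  then have "inj_on (\<lambda>(x, y). (x, j x y)) (Sigma A B)"
    by (auto simp: inj_on_def)
  moreover have "(\<lambda>(x, y). (x, j x y)) ` Sigma A B \<subseteq> A \<times> U"
    using j by auto
  ultimately show ?thesis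
    unfolding lepoll_def by blast
qed

text \<open>Points of a model have to be elements of \<open>'u\<close>, not equivalence classes. A
  class is therefore coded by the image of a chosen representative under an injection of
  \<open>A\<close>.\<close>

lemma quotient_code_exists:
  assumes R: "equiv A R" and A: "A \<lesssim> (UNIV :: 'u set)"
  shows "\<exists>code :: 'b \<Rightarrow> 'u. \<forall>x\<in>A. \<forall>y\<in>A. code x = code y \<longleftrightarrow> (x, y) \<in> R"
proof -
  obtain j :: "'b \<Rightarrow> 'u" where j: "inj_on j A"
    using A by (auto simp: lepoll_def)
  define r where "r x = (SOME y. (x, y) \<in> R)" for x
  have r: "(x, r x) \<in> R" if "x \<in> A" for x
    unfolding r_def by (rule someI[of _ x]) (meson R equivE refl_onD that)
  have "j (r x) = j (r y) \<longleftrightarrow> (x, y) \<in> R" if "x \<in> A" "y \<in> A" for x y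
  proof
    assume "j (r x) = j (r y)"
    moreover have "r x \<in> A" "r y \<in> A"
      using r[OF that(1)] r[OF that(2)] equiv_type[OF R] by blast+
    ultimately have "r x = r y"
      using j by (meson inj_onD)
    then show "(x, y) \<in> R"
      using r[OF that(1)] r[OF that(2)] R by (metis equivE symD transD)
  next
    assume "(x, y) \<in> R"
    \<comment> \<open>Related elements are related to the same things, so the choice in
      \<open>r\<close> selects the same representative for both.\<close>
    then have "(x, z) \<in> R \<longleftrightarrow> (y, z) \<in> R" for z
      using R by (metis equivE symD transD)
    then show "j (r x) = j (r y)"
      by (simp add: r_def)
  qed
  then show ?thesis
    by (intro exI[of _ "\<lambda>x. j (r x)"]) blast
qed

section \<open>Filters and power set lattices\<close>

text \<open>Zorn's lemma for filters in a preorder where \<open>m\<close> is a meet only up to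
  mutual \<open>le\<close>, so that it applies to formulas before any quotient is taken. The last
  conclusion is the form of maximality from which primeness follows once joins are
  available.\<close>

lemma maximal_filter_exists:
  fixes le :: "'e \<Rightarrow> 'e \<Rightarrow> bool"
  assumes refl: "\<And>p. p \<in> E \<Longrightarrow> le p p"
    and trans: "\<And>p q r. \<lbrakk>le p q; le q r; p \<in> E; q \<in> E; r \<in> E\<rbrakk> \<Longrightarrow> le p r"
    and m_in: "\<And>p q. \<lbrakk>p \<in> E; q \<in> E\<rbrakk> \<Longrightarrow> m p q \<in> E"
    and m1: "\<And>p q. \<lbrakk>p \<in> E; q \<in> E\<rbrakk> \<Longrightarrow> le (m p q) p"
    and m2: "\<And>p q. \<lbrakk>p \<in> E; q \<in> E\<rbrakk> \<Longrightarrow> le (m p q) q"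
    and m_glb: "\<And>p q r. \<lbrakk>le r p; le r q; p \<in> E; q \<in> E; r \<in> E\<rbrakk> \<Longrightarrow> le r (m p q)"
    and F: "F \<subseteq> E" "F \<noteq> {}" "\<And>p q. \<lbrakk>p \<in> F; q \<in> E; le p q\<rbrakk> \<Longrightarrow> q \<in> F"
      "\<And>p q. \<lbrakk>p \<in> F; q \<in> F\<rbrakk> \<Longrightarrow> m p q \<in> F"
    and N: "\<And>p q. \<lbrakk>p \<in> E; q \<in> N; le p q\<rbrakk> \<Longrightarrow> p \<in> N" and disj: "F \<inter> N = {}"
  obtains G where "F \<subseteq> G" "G \<subseteq> E" "G \<inter> N = {}"
    "\<And>p q. \<lbrakk>p \<in> G; q \<in> E; le p q\<rbrakk> \<Longrightarrow> q \<in> G"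
    "\<And>p q. \<lbrakk>p \<in> G; q \<in> G\<rbrakk> \<Longrightarrow> m p q \<in> G"
    "\<And>p. \<lbrakk>p \<in> E; p \<notin> G\<rbrakk> \<Longrightarrow> \<exists>x\<in>G. m x p \<in> N"
proof -
  define \<F> where "\<F> = {G. F \<subseteq> G \<and> G \<subseteq> E \<and> G \<inter> N = {} \<and>
    (\<forall>p\<in>G. \<forall>q\<in>E. le p q \<longrightarrow> q \<in> G) \<and> (\<forall>p\<in>G. \<forall>q\<in>G. m p q \<in> G)}"
  have \<F>I: "G \<in> \<F>" if "F \<subseteq> G" "G \<subseteq> E" "G \<inter> N = {}" "\<And>p q. \<lbrakk>p \<in> G; q \<in> E; le p q\<rbrakk> \<Longrightarrow> q \<in> G"
    "\<And>p q. \<lbrakk>p \<in> G; q \<in> G\<rbrakk> \<Longrightarrow> m p q \<in> G" for G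
    unfolding \<F>_def using that by blast
  have \<F>D: "F \<subseteq> G" "G \<subseteq> E" "G \<inter> N = {}" "\<And>p q. \<lbrakk>p \<in> G; q \<in> E; le p q\<rbrakk> \<Longrightarrow> q \<in> G"
    "\<And>p q. \<lbrakk>p \<in> G; q \<in> G\<rbrakk> \<Longrightarrow> m p q \<in> G" if "G \<in> \<F>" for G
    using that unfolding \<F>_def by blast+
  have "\<exists>G\<in>\<F>. \<forall>H\<in>\<F>. G \<subseteq> H \<longrightarrow> H = G"
  proof (rule subset_Zorn_nonempty)
    have "F \<in> \<F>"
      using F disj by (intro \<F>I) auto
    then show "\<F> \<noteq> {}"
      by blast
  next
    fix \<C> assume ne: "\<C> \<noteq> {}" and ch: "subset.chain \<F> \<C>"
    have sub: "\<C> \<subseteq> \<F>" and tot: "\<And>G H. \<lbrakk>G \<in> \<C>; H \<in> \<C>\<rbrakk> \<Longrightarrow> G \<subseteq> H \<or> H \<subseteq> G"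
      using ch by (auto simp: subset.chain_def)
    have "m p q \<in> \<Union>\<C>" if pq: "p \<in> \<Union>\<C>" "q \<in> \<Union>\<C>" for p q
    proof -
      obtain G H where "G \<in> \<C>" "H \<in> \<C>" "p \<in> G" "q \<in> H"
        using pq by auto
      then obtain G where "G \<in> \<C>" "p \<in> G" "q \<in> G"
        using tot by blast
      then show ?thesis
        using sub \<F>D(5) by blast
    qed
    moreover have "q \<in> \<Union>\<C>" if "p \<in> \<Union>\<C>" "q \<in> E" "le p q" for p q
      using that sub \<F>D(4) by blast
    moreover have "F \<subseteq> \<Union>\<C>" "\<Union>\<C> \<subseteq> E" "\<Union>\<C> \<inter> N = {}"
      using ne sub \<F>D(1-3) by blast+
    ultimately show "\<Union>\<C> \<in> \<F>"
      by (intro \<F>I)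
  qed
  then obtain G where G: "G \<in> \<F>" and max: "\<And>H. \<lbrakk>H \<in> \<F>; G \<subseteq> H\<rbrakk> \<Longrightarrow> H = G"
    by blast
  have Gs: "F \<subseteq> G" "G \<subseteq> E" "G \<inter> N = {}"
    and up: "\<And>p q. \<lbrakk>p \<in> G; q \<in> E; le p q\<rbrakk> \<Longrightarrow> q \<in> G"
    and mt: "\<And>p q. \<lbrakk>p \<in> G; q \<in> G\<rbrakk> \<Longrightarrow> m p q \<in> G"
    using \<F>D[OF G] by blast+
  have "\<exists>x\<in>G. m x p \<in> N" if p: "p \<in> E" "p \<notin> G" for p
  proof (rule ccontr)
    assume no: "\<not> (\<exists>x\<in>G. m x p \<in> N)"
    \<comment> \<open>\<open>H\<close> is the filter generated by \<open>G\<close> and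
      \<open>p\<close>. Under the assumption it is disjoint from \<open>N\<close>, so maximality
      forces \<open>H = G\<close>, against \<open>p \<in> H\<close>.\<close>
    define H where "H = {z \<in> E. \<exists>x\<in>G. le (m x p) z}"
    have GH: "G \<subseteq> H"
      using Gs(2) m1[OF _ p(1)] by (auto simp: H_def)
    have "m y z \<in> H" if y: "y \<in> H" and z: "z \<in> H" for y z
    proof -
      obtain a b where ab: "a \<in> G" "b \<in> G" "le (m a p) y" "le (m b p) z"
        using y z by (auto simp: H_def)
      have in_E: "a \<in> E" "b \<in> E" "y \<in> E" "z \<in> E"
        using ab Gs(2) y z by (auto simp: H_def)
      then have m_E: "m a b \<in> E" "m a p \<in> E" "m b p \<in> E" "m (m a b) p \<in> E"
        by (simp_all add: m_in p)
      \<comment> \<open>With \<open>m a b\<close> again in \<open>G\<close>, the element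
        \<open>m (m a b) p\<close> is a common lower bound of the generators \<open>m a p\<close>
        and \<open>m b p\<close>, which puts \<open>m y z\<close> into \<open>H\<close>.\<close>
      have "le (m (m a b) p) a" "le (m (m a b) p) b"
        using trans[OF m1[of "m a b" p] m1[of a b]] trans[OF m1[of "m a b" p] m2[of a b]] in_E m_E p
        by simp_all
      then have "le (m (m a b) p) (m a p)" "le (m (m a b) p) (m b p)"
        using m_glb m2 in_E m_E p by simp_all
      then have "le (m (m a b) p) y" "le (m (m a b) p) z"
        using trans[OF _ ab(3)] trans[OF _ ab(4)] in_E m_E by simp_all
      then have "le (m (m a b) p) (m y z)"
        using m_glb in_E m_E by simp
      then show ?thesis
        using mt[OF ab(1,2)] m_in in_E unfolding H_def by blast
    qed
    moreover have "q \<in> H" if q: "z \<in> H" "q \<in> E" "le z q" for z q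
    proof -
      obtain x where x: "x \<in> G" "le (m x p) z" "z \<in> E"
        using q by (auto simp: H_def)
      then have "le (m x p) q"
        using trans[OF x(2) q(3)] m_in p(1) q(2) Gs(2) by blast
      then show ?thesis
        using x q by (auto simp: H_def)
    qed
    moreover have "H \<inter> N = {}"
      using no N m_in[OF subsetD[OF Gs(2)] p(1)] unfolding H_def by blast
    moreover have "F \<subseteq> H" "H \<subseteq> E"
      using GH Gs(1) by (auto simp: H_def)
    ultimately have "H \<in> \<F>"
      by (intro \<F>I)
    moreover have "p \<in> H"
      using F(2) Gs(1) m2[OF subsetD[OF Gs(2)] p(1)] p(1) unfolding H_def by blast
    ultimately show False
      using max GH p(2) by blast
  qed
  with Gs up mt show ?thesis
    by (rule that)
qed

section \<open>Lattice operations on a power set\<close>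

lemma carrier_powerset_lattice [simp]: "carrier (powerset_lattice U) = Pow U"
  by (simp add: powerset_lattice_def)

text \<open>The equivalence pins down the only greatest element, so the choice operators behind
  infimum and top rewrite to one known set.\<close>

lemma greatest_powerset_lattice:
  assumes "\<A> \<subseteq> Pow U" "V \<in> \<A>" "\<And>W. W \<in> \<A> \<Longrightarrow> W \<subseteq> V"
  shows "greatest (powerset_lattice U) W \<A> \<longleftrightarrow> W = V"
  unfolding greatest_def powerset_lattice_def
  using assms by (metis gorder.select_convs(1) partial_object.select_convs(1) subset_antisym)

lemma least_powerset_lattice:
  assumes "\<A> \<subseteq> Pow U" "V \<in> \<A>" "\<And>W. W \<in> \<A> \<Longrightarrow> V \<subseteq> W"
  shows "least (powerset_lattice U) W \<A> \<longleftrightarrow> W = V"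
  unfolding least_def powerset_lattice_def
  using assms by (metis gorder.select_convs(1) partial_object.select_convs(1) subset_antisym)

lemma greatest_Lower_powerset_lattice:
  assumes "A \<subseteq> U" "B \<subseteq> U"
  shows "greatest (powerset_lattice U) W (Lower (powerset_lattice U) {A, B}) \<longleftrightarrow> W = A \<inter> B"
  by (rule greatest_powerset_lattice) (use assms in \<open>auto simp: powerset_lattice_def Lower_def\<close>)

lemma least_Upper_powerset_lattice:
  assumes "A \<subseteq> U" "B \<subseteq> U"
  shows "least (powerset_lattice U) W (Upper (powerset_lattice U) {A, B}) \<longleftrightarrow> W = A \<union> B"
  by (rule least_powerset_lattice) (use assms in \<open>auto simp: powerset_lattice_def Upper_def\<close>)

lemma powerset_lattice_meet:
  "\<lbrakk>A \<subseteq> U; B \<subseteq> U\<rbrakk> \<Longrightarrow> A \<sqinter>\<^bsub>powerset_lattice U\<^esub> B = A \<inter> B"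
  by (simp add: meet_def Lattice.inf_def greatest_Lower_powerset_lattice)

lemma powerset_lattice_join:
  "\<lbrakk>A \<subseteq> U; B \<subseteq> U\<rbrakk> \<Longrightarrow> A \<squnion>\<^bsub>powerset_lattice U\<^esub> B = A \<union> B"
  by (simp add: join_def Lattice.sup_def least_Upper_powerset_lattice)

lemma powerset_lattice_top: "\<top>\<^bsub>powerset_lattice U\<^esub> = U"
proof -
  have "greatest (powerset_lattice U) W (Pow U) \<longleftrightarrow> W = U" for W
    by (rule greatest_powerset_lattice) auto
  then show ?thesis
    by (simp add: top_def)
qed

lemma powerset_lattice_bottom: "\<bottom>\<^bsub>powerset_lattice U\<^esub> = {}"
proof -
  have "least (powerset_lattice U) W (Pow U) \<longleftrightarrow> W = {}" for W
    by (rule least_powerset_lattice) auto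
  then show ?thesis
    by (simp add: bottom_def)
qed

lemma lattice_powerset_lattice: "lattice (powerset_lattice U)"
  by unfold_locales
    (auto simp: least_Upper_powerset_lattice greatest_Lower_powerset_lattice,
     auto simp: powerset_lattice_def)

section \<open>Boolean doctrines\<close>

locale bool_doctrine =
  fixes C :: "('o, 'a) fpcat" and P :: "('o, 'a, 'p) doctrine"
  assumes doctrine: "boolean_doctrine C P"
begin

abbreviation hom :: "'o \<Rightarrow> 'o \<Rightarrow> 'a set" where
  "hom \<equiv> Homs C"

abbreviation comp :: "'a \<Rightarrow> 'a \<Rightarrow> 'a" (infixl \<open>\<cdot>\<close> 70) where
  "g \<cdot> f \<equiv> Comp C g f"

abbreviation fib :: "'o \<Rightarrow> 'p set" where
  "fib X \<equiv> carrier (Fib P X)"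

abbreviation fib_le :: "'p \<Rightarrow> 'o \<Rightarrow> 'p \<Rightarrow> bool" (\<open>_ \<le>[_] _\<close> [51, 0, 51] 50) where
  "\<alpha> \<le>[X] \<beta> \<equiv> \<alpha> \<sqsubseteq>\<^bsub>Fib P X\<^esub> \<beta>"

abbreviation reindex :: "'a \<Rightarrow> 'p \<Rightarrow> 'p" (\<open>_\<^sup>\<star>\<close> [1000] 1000) where
  "f\<^sup>\<star> \<equiv> Reidx P f"

lemma is_category: "is_category C"
  and Trm_terminal: "is_terminal C (Trm C)"
  and Prd_product: "\<lbrakk>X \<in> Obj C; Y \<in> Obj C\<rbrakk> \<Longrightarrow> is_product C X Y (Prd C X Y) (Pr1 C X Y) (Pr2 C X Y)"
  using doctrine by (auto simp: boolean_doctrine_def fp_category_def)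

lemma hom_Obj: "f \<in> hom X Y \<Longrightarrow> X \<in> Obj C" "f \<in> hom X Y \<Longrightarrow> Y \<in> Obj C"
  using is_category by (auto simp: is_category_def Homs_def)

lemma comp_hom: "\<lbrakk>g \<in> hom Y Z; f \<in> hom X Y\<rbrakk> \<Longrightarrow> g \<cdot> f \<in> hom X Z"
  using is_category hom_Obj unfolding is_category_def by metis

lemma comp_assoc: "\<lbrakk>h \<in> hom Y Z; g \<in> hom X Y; f \<in> hom W X\<rbrakk> \<Longrightarrow> h \<cdot> g \<cdot> f = h \<cdot> (g \<cdot> f)"
  using is_category hom_Obj unfolding is_category_def by metis

lemma Id_hom: "X \<in> Obj C \<Longrightarrow> Id C X \<in> hom X X"
  using is_category by (simp add: is_category_def)

lemma comp_Id: "f \<in> hom X Y \<Longrightarrow> f \<cdot> Id C X = f" "f \<in> hom X Y \<Longrightarrow> Id C Y \<cdot> f = f"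
  using is_category hom_Obj unfolding is_category_def by metis+

lemma Trm_Obj: "Trm C \<in> Obj C"
  using Trm_terminal by (simp add: is_terminal_def)

lemma terminal_ext: "\<lbrakk>is_terminal C T; f \<in> hom X T; g \<in> hom X T\<rbrakk> \<Longrightarrow> f = g"
  using hom_Obj unfolding is_terminal_def by metis

lemma terminal_arrow: "\<lbrakk>is_terminal C T; X \<in> Obj C\<rbrakk> \<Longrightarrow> \<exists>f. f \<in> hom X T"
  unfolding is_terminal_def by metis

lemma product_ext:
  assumes "is_product C X Y Z p q" "f \<in> hom W Z" "g \<in> hom W Z" "p \<cdot> f = p \<cdot> g" "q \<cdot> f = q \<cdot> g"
  shows "f = g"
proof -
  have "p \<cdot> g \<in> hom W X" "q \<cdot> g \<in> hom W Y"
    using assms comp_hom unfolding is_product_def by blast+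
  then have "\<exists>!h. h \<in> hom W Z \<and> p \<cdot> h = p \<cdot> g \<and> q \<cdot> h = q \<cdot> g"
    using assms hom_Obj(1)[OF assms(2)] unfolding is_product_def by blast
  then show ?thesis
    using assms by auto
qed

lemma product_arrow:
  assumes "is_product C X Y Z p q" "f \<in> hom W X" "g \<in> hom W Y"
  shows "\<exists>h. h \<in> hom W Z \<and> p \<cdot> h = f \<and> q \<cdot> h = g"
  using assms hom_Obj(1)[OF assms(2)] unfolding is_product_def by blast

lemma product_Prd_homs:
  assumes "X \<in> Obj C" "Y \<in> Obj C"
  shows "Prd C X Y \<in> Obj C" "Pr1 C X Y \<in> hom (Prd C X Y) X" "Pr2 C X Y \<in> hom (Prd C X Y) Y"
  using Prd_product[OF assms] by (auto simp: is_product_def)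

lemma fibre: "X \<in> Obj C \<Longrightarrow> boolean_lattice (Fib P X)"
  using doctrine by (simp add: boolean_doctrine_def)

lemma reindex_hom: "f \<in> hom X Y \<Longrightarrow> boolean_hom (Fib P Y) (Fib P X) f\<^sup>\<star>"
  using doctrine hom_Obj unfolding boolean_doctrine_def by blast

lemma reindex_closed: "\<lbrakk>f \<in> hom X Y; \<alpha> \<in> fib Y\<rbrakk> \<Longrightarrow> f\<^sup>\<star> \<alpha> \<in> fib X"
  using reindex_hom[of f X Y] by (auto simp: boolean_hom_def)

lemma reindex_meet:
  "\<lbrakk>f \<in> hom X Y; \<alpha> \<in> fib Y; \<beta> \<in> fib Y\<rbrakk> \<Longrightarrow> f\<^sup>\<star> (\<alpha> \<sqinter>\<^bsub>Fib P Y\<^esub> \<beta>) = f\<^sup>\<star> \<alpha> \<sqinter>\<^bsub>Fib P X\<^esub> f\<^sup>\<star> \<beta>"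
  using reindex_hom by (simp add: boolean_hom_def meet_pres_def)

lemma reindex_join:
  "\<lbrakk>f \<in> hom X Y; \<alpha> \<in> fib Y; \<beta> \<in> fib Y\<rbrakk> \<Longrightarrow> f\<^sup>\<star> (\<alpha> \<squnion>\<^bsub>Fib P Y\<^esub> \<beta>) = f\<^sup>\<star> \<alpha> \<squnion>\<^bsub>Fib P X\<^esub> f\<^sup>\<star> \<beta>"
  using reindex_hom by (simp add: boolean_hom_def join_pres_def)

lemma reindex_top: "f \<in> hom X Y \<Longrightarrow> f\<^sup>\<star> \<top>\<^bsub>Fib P Y\<^esub> = \<top>\<^bsub>Fib P X\<^esub>"
  using reindex_hom by (simp add: boolean_hom_def)

lemma reindex_bottom: "f \<in> hom X Y \<Longrightarrow> f\<^sup>\<star> \<bottom>\<^bsub>Fib P Y\<^esub> = \<bottom>\<^bsub>Fib P X\<^esub>"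
  using reindex_hom by (simp add: boolean_hom_def)

lemma reindex_mono: "\<lbrakk>f \<in> hom X Y; \<alpha> \<in> fib Y; \<beta> \<in> fib Y; \<alpha> \<le>[Y] \<beta>\<rbrakk> \<Longrightarrow> f\<^sup>\<star> \<alpha> \<le>[X] f\<^sup>\<star> \<beta>"
  using reindex_hom[of f X Y] join_pres_isotone[of "f\<^sup>\<star>" "Fib P Y" "Fib P X"]
  by (simp add: boolean_hom_def isotone_def)

lemma reindex_comp: "\<lbrakk>g \<in> hom Y Z; f \<in> hom X Y; \<alpha> \<in> fib Z\<rbrakk> \<Longrightarrow> (g \<cdot> f)\<^sup>\<star> \<alpha> = f\<^sup>\<star> (g\<^sup>\<star> \<alpha>)"
  using doctrine hom_Obj unfolding boolean_doctrine_def by blast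

lemma fib_le_trans:
  "\<lbrakk>\<alpha> \<le>[X] \<beta>; \<beta> \<le>[X] \<gamma>; X \<in> Obj C; \<alpha> \<in> fib X; \<beta> \<in> fib X; \<gamma> \<in> fib X\<rbrakk> \<Longrightarrow> \<alpha> \<le>[X] \<gamma>"
  using fibre[of X] by (meson boolean_lattice_def bounded_lattice.axioms(1) lattice_def
      partial_order.axioms(1) upper_semilattice.axioms(1) weak_partial_order.le_trans)

section \<open>Finite meets of instances of a formula\<close>

text \<open>An iterated binary meet over a list replaces the infimum of a set: homomorphisms pass
  through it by induction, and the empty list gives the top element.\<close>

definition inst_meet :: "'o \<Rightarrow> 'p \<Rightarrow> 'a list \<Rightarrow> 'p" where
  "inst_meet X \<alpha> fs = foldr (\<lambda>f \<gamma>. f\<^sup>\<star> \<alpha> \<sqinter>\<^bsub>Fib P X\<^esub> \<gamma>) fs \<top>\<^bsub>Fib P X\<^esub>"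

lemma inst_meet_Nil [simp]: "inst_meet X \<alpha> [] = \<top>\<^bsub>Fib P X\<^esub>"
  and inst_meet_Cons [simp]: "inst_meet X \<alpha> (f # fs) = f\<^sup>\<star> \<alpha> \<sqinter>\<^bsub>Fib P X\<^esub> inst_meet X \<alpha> fs"
  by (simp_all add: inst_meet_def)

text \<open>All three properties of a greatest lower bound go through one induction, since the step
  uses each of them for the shorter list.\<close>

lemma inst_meet_greatest:
  assumes X: "X \<in> Obj C" and \<alpha>: "\<alpha> \<in> fib Y" and fs: "set fs \<subseteq> hom X Y"
  shows "inst_meet X \<alpha> fs \<in> fib X \<and> (\<forall>f\<in>set fs. inst_meet X \<alpha> fs \<le>[X] f\<^sup>\<star> \<alpha>) \<and>
    (\<forall>\<gamma>\<in>fib X. (\<forall>f\<in>set fs. \<gamma> \<le>[X] f\<^sup>\<star> \<alpha>) \<longrightarrow> \<gamma> \<le>[X] inst_meet X \<alpha> fs)"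
  using fs
proof (induction fs)
  interpret L: boolean_lattice "Fib P X"
    using X by (rule fibre)
  case Nil
  show ?case
    by (simp add: L.top_higher)
next
  interpret L: boolean_lattice "Fib P X"
    using X by (rule fibre)
  case (Cons f fs)
  have f: "f\<^sup>\<star> \<alpha> \<in> fib X"
    using Cons.prems \<alpha> reindex_closed by auto
  have c: "inst_meet X \<alpha> fs \<in> fib X" and lb: "\<forall>f\<in>set fs. inst_meet X \<alpha> fs \<le>[X] f\<^sup>\<star> \<alpha>"
    and gr: "\<forall>\<gamma>\<in>fib X. (\<forall>f\<in>set fs. \<gamma> \<le>[X] f\<^sup>\<star> \<alpha>) \<longrightarrow> \<gamma> \<le>[X] inst_meet X \<alpha> fs"
    using Cons by auto
  have "inst_meet X \<alpha> (f # fs) \<le>[X] g\<^sup>\<star> \<alpha>" if "g \<in> set fs" for g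
  proof -
    have "g\<^sup>\<star> \<alpha> \<in> fib X"
      using that Cons.prems \<alpha> reindex_closed by auto
    then show ?thesis
      using L.le_trans[OF L.meet_right[OF f c]] lb that f c by simp
  qed
  then show ?case
    using f c gr L.meet_left[OF f c] L.meet_le by auto
qed

text \<open>Greatest lower bounds are unique in a partial order, so the infimum in the first clause
  of a universal ideal is the iterated meet.\<close>

lemma inst_meet_eq_inf:
  assumes X: "X \<in> Obj C" and \<alpha>: "\<alpha> \<in> fib Y" and fs: "set fs \<subseteq> hom X Y"
  shows "\<Sqinter>\<^bsub>Fib P X\<^esub>((\<lambda>f. f\<^sup>\<star> \<alpha>) ` set fs) = inst_meet X \<alpha> fs"
proof -
  interpret L: boolean_lattice "Fib P X"
    using X by (rule fibre)
  let ?A = "(\<lambda>f. f\<^sup>\<star> \<alpha>) ` set fs"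
  have "f\<^sup>\<star> \<alpha> \<in> fib X" if "f \<in> set fs" for f
    using that fs reindex_closed[OF _ \<alpha>] by blast
  then have "Lower (Fib P X) ?A = {\<gamma> \<in> fib X. \<forall>f\<in>set fs. \<gamma> \<le>[X] f\<^sup>\<star> \<alpha>}"
    by (auto simp: Lower_def)
  then have "greatest (Fib P X) (inst_meet X \<alpha> fs) (Lower (Fib P X) ?A)"
    using inst_meet_greatest[OF assms] by (auto simp: greatest_def)
  then show ?thesis
    unfolding Lattice.inf_def using L.greatest_unique by (intro some_equality) auto
qed

text \<open>Reindexing preserves top and binary meets, and the instance along \<open>f\<close>
  becomes the instance along \<open>f \<cdot> r\<close>. Hence meets of instances remain meets of
  instances in larger contexts.\<close>

lemma inst_meet_reindex:
  assumes r: "r \<in> hom W X" and \<alpha>: "\<alpha> \<in> fib Y" and fs: "set fs \<subseteq> hom X Y"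
  shows "r\<^sup>\<star> (inst_meet X \<alpha> fs) = inst_meet W \<alpha> (map (\<lambda>f. f \<cdot> r) fs)"
  using fs
proof (induction fs)
  case Nil
  then show ?case
    using r by (simp add: reindex_top)
next
  case (Cons f fs)
  then have f: "f \<in> hom X Y" and c: "inst_meet X \<alpha> fs \<in> fib X"
    using inst_meet_greatest[OF hom_Obj(2)[OF r] \<alpha>] by auto
  show ?case
    using Cons reindex_meet[OF r reindex_closed[OF f \<alpha>] c] reindex_comp[OF f r \<alpha>] by simp
qed

end

section \<open>Contexts of witnesses\<close>

locale ideal_contexts = bool_doctrine C P
  for C :: "('o, 'a) fpcat" and P :: "('o, 'a, 'p) doctrine" +
  fixes I :: "'o \<Rightarrow> 'p set"
  assumes ideal: "universal_ideal C P I"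
begin

lemma ideal_fib: "X \<in> Obj C \<Longrightarrow> I X \<subseteq> fib X"
  using ideal by (simp add: universal_ideal_def)

lemma ideal_inst_meet:
  assumes "\<alpha> \<in> fib Y" "X \<in> Obj C" "Y \<in> Obj C" "set fs \<subseteq> hom X Y" "inst_meet X \<alpha> fs \<in> I X"
  shows "\<alpha> \<in> I Y"
  using assms ideal inst_meet_eq_inf[of X \<alpha> Y fs] unfolding universal_ideal_def by metis

lemma ideal_downward: "\<lbrakk>X \<in> Obj C; \<alpha> \<in> I X; \<beta> \<in> fib X; \<beta> \<le>[X] \<alpha>\<rbrakk> \<Longrightarrow> \<beta> \<in> I X"
  using ideal unfolding universal_ideal_def by blast

lemma ideal_join:
  "\<lbrakk>X \<in> Obj C; Y \<in> Obj C; \<alpha> \<in> I X; \<beta> \<in> I Y\<rbrakk> \<Longrightarrow>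
    (Pr1 C X Y)\<^sup>\<star> \<alpha> \<squnion>\<^bsub>Fib P (Prd C X Y)\<^esub> (Pr2 C X Y)\<^sup>\<star> \<beta> \<in> I (Prd C X Y)"
  using ideal unfolding universal_ideal_def join_closed_over_products_def by blast

lemma ideal_bottom: "\<bottom>\<^bsub>Fib P (Trm C)\<^esub> \<in> I (Trm C)"
  using ideal by (simp add: universal_ideal_def)

text \<open>A witness \<open>(Y, \<beta>)\<close> is a fresh constant of sort \<open>Y\<close> at which \<open>\<beta>\<close> is to fail.\<close>

definition witnesses :: "('o \<times> 'p) set" where
  "witnesses = Sigma (Obj C) I"

text \<open>A list in place of a finite set makes the product available by recursion; repeated
  witnesses give repeated factors.\<close>

primrec ctx :: "('o \<times> 'p) list \<Rightarrow> 'o" where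
  "ctx [] = Trm C"
| "ctx (k # S) = Prd C (fst k) (ctx S)"

text \<open>The projection to the first factor labelled \<open>k\<close>. The value at the empty
  list is a default, reached only if \<open>k\<close> is not in the list.\<close>

primrec var :: "('o \<times> 'p) list \<Rightarrow> 'o \<times> 'p \<Rightarrow> 'a" where
  "var [] k = undefined"
| "var (j # S) k = (if k = j then Pr1 C (fst j) (ctx S) else var S k \<cdot> Pr2 C (fst j) (ctx S))"

text \<open>\<open>res S T\<close> restricts from \<open>T\<close> to \<open>S\<close>. It is functorial on composites only: \<open>res S S\<close> is not the
  identity if \<open>S\<close> has repetitions.\<close>

primrec res :: "('o \<times> 'p) list \<Rightarrow> ('o \<times> 'p) list \<Rightarrow> 'a" where
  "res [] T = (SOME h. h \<in> hom (ctx T) (Trm C))"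
| "res (k # S) T = (SOME h. h \<in> hom (ctx T) (ctx (k # S)) \<and>
     Pr1 C (fst k) (ctx S) \<cdot> h = var T k \<and> Pr2 C (fst k) (ctx S) \<cdot> h = res S T)"

text \<open>The join of the witness formulas of the list, each placed at its own factor of the
  context.\<close>

primrec refuted :: "('o \<times> 'p) list \<Rightarrow> 'p" where
  "refuted [] = \<bottom>\<^bsub>Fib P (Trm C)\<^esub>"
| "refuted (k # S) = (Pr1 C (fst k) (ctx S))\<^sup>\<star> (snd k)
     \<squnion>\<^bsub>Fib P (ctx (k # S))\<^esub> (Pr2 C (fst k) (ctx S))\<^sup>\<star> (refuted S)"

text \<open>Contexts are compared by their sets of witnesses, so \<open>S @ T\<close> is a common
  extension of two lists of witnesses \<open>S\<close> and \<open>T\<close>. Well-formedness of the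
  larger list is built in and passes to the smaller one.\<close>

definition ext :: "('o \<times> 'p) list \<Rightarrow> ('o \<times> 'p) list \<Rightarrow> bool" (infix \<open>\<preceq>\<close> 50) where
  "S \<preceq> T \<longleftrightarrow> set T \<subseteq> witnesses \<and> set S \<subseteq> set T"

lemma ext_trans: "S \<preceq> T \<Longrightarrow> T \<preceq> U \<Longrightarrow> S \<preceq> U"
  by (auto simp: ext_def)

lemma ext_refl: "set S \<subseteq> witnesses \<Longrightarrow> S \<preceq> S"
  by (simp add: ext_def)

lemma ext_append: "\<lbrakk>set S \<subseteq> witnesses; set T \<subseteq> witnesses\<rbrakk> \<Longrightarrow> S \<preceq> S @ T"
  "\<lbrakk>set S \<subseteq> witnesses; set T \<subseteq> witnesses\<rbrakk> \<Longrightarrow> T \<preceq> S @ T"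
  by (auto simp: ext_def)

lemma ext_witnesses: "S \<preceq> T \<Longrightarrow> set S \<subseteq> witnesses" "S \<preceq> T \<Longrightarrow> set T \<subseteq> witnesses"
  by (auto simp: ext_def)

lemma witness_Obj: "k \<in> witnesses \<Longrightarrow> fst k \<in> Obj C"
  and witness_ideal: "k \<in> witnesses \<Longrightarrow> snd k \<in> I (fst k)"
  and witness_fib: "k \<in> witnesses \<Longrightarrow> snd k \<in> fib (fst k)"
  using ideal_fib by (auto simp: witnesses_def subset_iff)

lemma ctx_Obj: "set S \<subseteq> witnesses \<Longrightarrow> ctx S \<in> Obj C"
  by (induction S) (auto simp: Trm_Obj witness_Obj product_Prd_homs)

lemma ctx_product:
  "set (k # S) \<subseteq> witnesses \<Longrightarrow>
    is_product C (fst k) (ctx S) (ctx (k # S)) (Pr1 C (fst k) (ctx S)) (Pr2 C (fst k) (ctx S))"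
  by (simp add: Prd_product witness_Obj ctx_Obj)

lemma ctx_projections:
  assumes "set (k # S) \<subseteq> witnesses"
  shows "Pr1 C (fst k) (ctx S) \<in> hom (ctx (k # S)) (fst k)"
    "Pr2 C (fst k) (ctx S) \<in> hom (ctx (k # S)) (ctx S)"
  using ctx_product[OF assms] by (auto simp: is_product_def)

lemma var_hom: "\<lbrakk>set S \<subseteq> witnesses; k \<in> set S\<rbrakk> \<Longrightarrow> var S k \<in> hom (ctx S) (fst k)"
proof (induction S)
  case (Cons j S)
  show ?case
  proof (cases "k = j")
    case True
    then show ?thesis
      using ctx_projections(1)[OF Cons.prems(1)] by simp
  next
    case False
    then have "var S k \<in> hom (ctx S) (fst k)"
      using Cons by auto
    then show ?thesis
      using comp_hom[OF _ ctx_projections(2)[OF Cons.prems(1)]] False by simp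
  qed
qed simp

text \<open>\<open>res S T\<close> is the tuple of the arrows \<open>var T k\<close> for the entries
  \<open>k\<close> of \<open>S\<close>. The choice in a recursive step needs the arrow for the tail
  to be well typed, so the one-step claim is isolated before the induction.\<close>

lemma res_hom: "S \<preceq> T \<Longrightarrow> res S T \<in> hom (ctx T) (ctx S)"
  and res_Cons: "k # S \<preceq> T \<Longrightarrow> Pr1 C (fst k) (ctx S) \<cdot> res (k # S) T = var T k \<and>
     Pr2 C (fst k) (ctx S) \<cdot> res (k # S) T = res S T"
proof -
  have *: "res (k # S) T \<in> hom (ctx T) (ctx (k # S)) \<and>
      Pr1 C (fst k) (ctx S) \<cdot> res (k # S) T = var T k \<and> Pr2 C (fst k) (ctx S) \<cdot> res (k # S) T = res S T"
    if "k # S \<preceq> T" "res S T \<in> hom (ctx T) (ctx S)" for k S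
    unfolding res.simps
  proof (rule someI_ex)
    show "\<exists>h. h \<in> hom (ctx T) (ctx (k # S)) \<and>
      Pr1 C (fst k) (ctx S) \<cdot> h = var T k \<and> Pr2 C (fst k) (ctx S) \<cdot> h = res S T"
      using that by (intro product_arrow[OF ctx_product] var_hom) (auto simp: ext_def)
  qed
  show hom: "res S T \<in> hom (ctx T) (ctx S)" if "S \<preceq> T" for S
    using that
  proof (induction S)
    case Nil
    then show ?case
      using someI_ex[OF terminal_arrow[OF Trm_terminal ctx_Obj]] by (simp add: ext_def)
  next
    case (Cons k S)
    then show ?case
      using *[OF Cons.prems] by (simp add: ext_def)
  qed
  show "Pr1 C (fst k) (ctx S) \<cdot> res (k # S) T = var T k \<and>
     Pr2 C (fst k) (ctx S) \<cdot> res (k # S) T = res S T" if "k # S \<preceq> T"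
    using *[OF that hom] that by (simp add: ext_def)
qed

text \<open>The first entry is read off the first component of \<open>res S T\<close>; a later entry
  is reached through the second projection and the induction hypothesis.\<close>

lemma var_res: "\<lbrakk>S \<preceq> T; k \<in> set S\<rbrakk> \<Longrightarrow> var S k \<cdot> res S T = var T k"
proof (induction S)
  case (Cons j S)
  show ?case
  proof (cases "k = j")
    case True
    then show ?thesis
      using res_Cons[OF Cons.prems(1)] by simp
  next
    case False
    have S: "S \<preceq> T" "set (j # S) \<subseteq> witnesses" "k \<in> set S"
      using Cons.prems False by (auto simp: ext_def)
    show ?thesis
      using comp_assoc[OF var_hom ctx_projections(2)[OF S(2)] res_hom[OF Cons.prems(1)], of k]
        res_Cons[OF Cons.prems(1)] Cons.IH[OF S(1,3)] S False by (simp del: res.simps ctx.simps)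
  qed
qed simp

text \<open>Both sides have the component \<open>var U k\<close> at every entry \<open>k\<close> of
  \<open>S\<close>, and arrows into a product are determined by their components. In particular
  \<open>res S T\<close> absorbs \<open>res T T\<close>, even if the latter is not the
  identity.\<close>

lemma res_res: "\<lbrakk>S \<preceq> T; T \<preceq> U\<rbrakk> \<Longrightarrow> res S T \<cdot> res T U = res S U"
proof (induction S)
  case Nil
  have "[] \<preceq> U"
    using Nil by (auto simp: ext_def)
  then show ?case
    using Nil res_hom[of "[]" U] comp_hom[OF res_hom res_hom, of "[]" T U] terminal_ext[OF Trm_terminal]
    by (simp del: res.simps)
next
  case (Cons k S)
  have ST: "S \<preceq> T" "k # S \<preceq> U" "set (k # S) \<subseteq> witnesses" "k \<in> set T"
    using Cons.prems by (auto simp: ext_def)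
  note r = res_hom[OF Cons.prems(1)] res_hom[OF Cons.prems(2)]
  note pr = ctx_projections[OF ST(3)]
  show ?case
  proof (rule product_ext[OF ctx_product[OF ST(3)] comp_hom[OF r] res_hom[OF ST(2)]])
    show "Pr1 C (fst k) (ctx S) \<cdot> (res (k # S) T \<cdot> res T U) = Pr1 C (fst k) (ctx S) \<cdot> res (k # S) U"
      using comp_assoc[OF pr(1) r] res_Cons[OF Cons.prems(1)] res_Cons[OF ST(2)]
        var_res[OF Cons.prems(2) ST(4)] by (simp del: res.simps)
    show "Pr2 C (fst k) (ctx S) \<cdot> (res (k # S) T \<cdot> res T U) = Pr2 C (fst k) (ctx S) \<cdot> res (k # S) U"
      using comp_assoc[OF pr(2) r] res_Cons[OF Cons.prems(1)] res_Cons[OF ST(2)]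
        Cons.IH[OF ST(1) Cons.prems(2)] by (simp del: res.simps)
  qed
qed

text \<open>Each recursive step is an instance of the closure of \<open>I\<close> under joins over
  products; the empty list is the clause on bottom.\<close>

lemma refuted_ideal: "set S \<subseteq> witnesses \<Longrightarrow> refuted S \<in> I (ctx S)"
  by (induction S) (auto simp: ideal_bottom ideal_join witness_Obj witness_ideal ctx_Obj)

lemma refuted_fib: "set S \<subseteq> witnesses \<Longrightarrow> refuted S \<in> fib (ctx S)"
  using refuted_ideal ideal_fib ctx_Obj by blast

lemma refuted_parts:
  assumes "set (k # S) \<subseteq> witnesses"
  shows "(Pr1 C (fst k) (ctx S))\<^sup>\<star> (snd k) \<in> fib (ctx (k # S))"
    "(Pr2 C (fst k) (ctx S))\<^sup>\<star> (refuted S) \<in> fib (ctx (k # S))"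
  using assms reindex_closed[OF ctx_projections(1)[OF assms] witness_fib]
    reindex_closed[OF ctx_projections(2)[OF assms] refuted_fib] by auto

lemma var_le_refuted:
  "\<lbrakk>set S \<subseteq> witnesses; k \<in> set S\<rbrakk> \<Longrightarrow> (var S k)\<^sup>\<star> (snd k) \<le>[ctx S] refuted S"
proof (induction S)
  case (Cons j S)
  interpret L: boolean_lattice "Fib P (ctx (j # S))"
    by (rule fibre[OF ctx_Obj[OF Cons.prems(1)]])
  note parts = refuted_parts[OF Cons.prems(1)]
  show ?case
  proof (cases "k = j")
    case True
    then show ?thesis
      using L.join_left[OF parts] by simp
  next
    case False
    then have S: "set S \<subseteq> witnesses" "k \<in> set S" "k \<in> witnesses"
      using Cons.prems by auto
    note pr = ctx_projections(2)[OF Cons.prems(1)]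
    have v: "(var S k)\<^sup>\<star> (snd k) \<in> fib (ctx S)"
      using reindex_closed var_hom witness_fib S by blast
    have "(Pr2 C (fst j) (ctx S))\<^sup>\<star> ((var S k)\<^sup>\<star> (snd k)) \<le>[ctx (j # S)]
        (Pr2 C (fst j) (ctx S))\<^sup>\<star> (refuted S)"
      using reindex_mono[OF pr v refuted_fib] Cons.IH S by blast
    then have "(Pr2 C (fst j) (ctx S))\<^sup>\<star> ((var S k)\<^sup>\<star> (snd k)) \<le>[ctx (j # S)] refuted (j # S)"
      using L.le_trans[OF _ L.join_right[OF parts]] L.join_closed[OF parts] parts
        reindex_closed[OF pr v] by simp
    then show ?thesis
      using reindex_comp[OF var_hom[OF S(1,2)] pr witness_fib[OF S(3)]] False by simp
  qed
qed simp

text \<open>Reindexing turns each disjunct into the same witness formula at its constant in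
  \<open>T\<close>, which is among the disjuncts of \<open>refuted T\<close>. Since \<open>T\<close>
  may contain further witnesses, only an inequality is claimed.\<close>

lemma res_refuted: "S \<preceq> T \<Longrightarrow> (res S T)\<^sup>\<star> (refuted S) \<le>[ctx T] refuted T"
proof (induction S)
  case Nil
  interpret L: boolean_lattice "Fib P (ctx T)"
    using Nil by (auto intro: fibre ctx_Obj simp: ext_def)
  show ?case
    using reindex_bottom[OF res_hom[OF Nil]] refuted_fib[of T] Nil L.bottom_lower
    by (simp del: res.simps add: ext_def)
next
  case (Cons k S)
  interpret L: boolean_lattice "Fib P (ctx T)"
    using Cons.prems by (auto intro: fibre ctx_Obj simp: ext_def)
  have S: "S \<preceq> T" "set T \<subseteq> witnesses" "set (k # S) \<subseteq> witnesses" "k \<in> set T" "k \<in> witnesses"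
    using Cons.prems by (auto simp: ext_def)
  note r = res_hom[OF Cons.prems] and pr = ctx_projections[OF S(3)] and parts = refuted_parts[OF S(3)]
  have S': "set S \<subseteq> witnesses"
    using S(3) by simp
  have "(res (k # S) T)\<^sup>\<star> (refuted (k # S)) = (var T k)\<^sup>\<star> (snd k) \<squnion>\<^bsub>Fib P (ctx T)\<^esub> (res S T)\<^sup>\<star> (refuted S)"
    using reindex_join[OF r parts] reindex_comp[OF pr(1) r witness_fib[OF S(5)]]
      reindex_comp[OF pr(2) r refuted_fib[OF S']] res_Cons[OF Cons.prems]
    by (simp del: res.simps ctx.simps)
  moreover have "(var T k)\<^sup>\<star> (snd k) \<in> fib (ctx T)" "(res S T)\<^sup>\<star> (refuted S) \<in> fib (ctx T)"
    using reindex_closed[OF var_hom[OF S(2,4)] witness_fib[OF S(5)]]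
      reindex_closed[OF res_hom[OF S(1)] refuted_fib[OF S']] .
  ultimately show ?case
    using L.join_le var_le_refuted[OF S(2,4)] Cons.IH[OF S(1)] refuted_fib[OF S(2)]
    by (simp del: res.simps)
qed

end

section \<open>The colimit of the fibres\<close>

context ideal_contexts
begin

text \<open>The formulas in the colimit of the fibres over the contexts; a pair \<open>(S, \<gamma>)\<close> is not
  identified with its restrictions to larger contexts but only equivalent to them.\<close>

definition formulas :: "(('o \<times> 'p) list \<times> 'p) set" where
  "formulas = {(S, \<gamma>). set S \<subseteq> witnesses \<and> \<gamma> \<in> fib (ctx S)}"

definition restr :: "('o \<times> 'p) list \<Rightarrow> ('o \<times> 'p) list \<times> 'p \<Rightarrow> 'p" where
  "restr U p = (res (fst p) U)\<^sup>\<star> (snd p)"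

text \<open>The order of the directed colimit: an inequality at some common extension of the two
  contexts.\<close>

definition entails :: "('o \<times> 'p) list \<times> 'p \<Rightarrow> ('o \<times> 'p) list \<times> 'p \<Rightarrow> bool" where
  "entails p q \<longleftrightarrow> (\<exists>U. fst p \<preceq> U \<and> fst q \<preceq> U \<and> restr U p \<le>[ctx U] restr U q)"

definition both :: "('o \<times> 'p) list \<times> 'p \<Rightarrow> ('o \<times> 'p) list \<times> 'p \<Rightarrow> ('o \<times> 'p) list \<times> 'p" where
  "both p q = (let U = fst p @ fst q in (U, restr U p \<sqinter>\<^bsub>Fib P (ctx U)\<^esub> restr U q))"

lemma formulasI: "\<lbrakk>set S \<subseteq> witnesses; \<gamma> \<in> fib (ctx S)\<rbrakk> \<Longrightarrow> (S, \<gamma>) \<in> formulas"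
  by (simp add: formulas_def)

lemma formulas_ctx: "p \<in> formulas \<Longrightarrow> set (fst p) \<subseteq> witnesses"
  and formulas_fib: "p \<in> formulas \<Longrightarrow> snd p \<in> fib (ctx (fst p))"
  by (auto simp: formulas_def)

lemma ext_fibre: "S \<preceq> U \<Longrightarrow> boolean_lattice (Fib P (ctx U))"
  by (auto intro: fibre ctx_Obj simp: ext_def)

lemma restr_fib: "\<lbrakk>p \<in> formulas; fst p \<preceq> U\<rbrakk> \<Longrightarrow> restr U p \<in> fib (ctx U)"
  unfolding restr_def by (rule reindex_closed[OF res_hom formulas_fib])

lemma res_restr:
  "\<lbrakk>p \<in> formulas; fst p \<preceq> U; U \<preceq> V\<rbrakk> \<Longrightarrow> (res U V)\<^sup>\<star> (restr U p) = restr V p"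
  unfolding restr_def by (simp add: reindex_comp[OF res_hom res_hom formulas_fib, symmetric] res_res)

text \<open>Reindexing is monotone and restrictions compose, so an inequality found at one context
  can be moved to any extension of it.\<close>

lemma restr_mono:
  assumes "p \<in> formulas" "q \<in> formulas" "fst p \<preceq> U" "fst q \<preceq> U" "U \<preceq> V" "restr U p \<le>[ctx U] restr U q"
  shows "restr V p \<le>[ctx V] restr V q"
  using reindex_mono[OF res_hom restr_fib restr_fib, of U V p q] assms by (simp add: res_restr)

lemma both_formulas:
  assumes "p \<in> formulas" "q \<in> formulas"
  shows "both p q \<in> formulas"
proof -
  have e: "fst p \<preceq> fst p @ fst q" "fst q \<preceq> fst p @ fst q"
    using assms by (simp_all add: ext_append formulas_ctx)
  interpret L: boolean_lattice "Fib P (ctx (fst p @ fst q))"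
    using e(1) by (rule ext_fibre)
  show ?thesis
    using assms e by (auto simp: both_def Let_def restr_fib ext_def intro!: formulasI)
qed

lemma fst_both [simp]: "fst (both p q) = fst p @ fst q"
  by (simp add: both_def Let_def)

lemma restr_both:
  assumes "p \<in> formulas" "q \<in> formulas" "fst p \<preceq> U" "fst q \<preceq> U"
  shows "restr U (both p q) = restr U p \<sqinter>\<^bsub>Fib P (ctx U)\<^esub> restr U q"
proof -
  have e: "fst p \<preceq> fst p @ fst q" "fst q \<preceq> fst p @ fst q" "fst p @ fst q \<preceq> U"
    using assms by (auto simp: ext_def)
  then have "restr U (both p q) = (res (fst p @ fst q) U)\<^sup>\<star> (restr (fst p @ fst q) p)
      \<sqinter>\<^bsub>Fib P (ctx U)\<^esub> (res (fst p @ fst q) U)\<^sup>\<star> (restr (fst p @ fst q) q)"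
    using assms unfolding restr_def[of U "both p q"]
    by (simp add: both_def Let_def restr_fib reindex_meet[OF res_hom])
  then show ?thesis
    using assms e by (simp add: res_restr)
qed

lemma entails_refl:
  assumes "p \<in> formulas"
  shows "entails p p"
proof -
  have e: "fst p \<preceq> fst p"
    using assms by (simp add: ext_refl formulas_ctx)
  interpret L: boolean_lattice "Fib P (ctx (fst p))"
    using e by (rule ext_fibre)
  show ?thesis
    unfolding entails_def using e assms restr_fib L.le_refl by blast
qed

lemma entails_trans:
  assumes "entails p q" "entails q r" and f: "p \<in> formulas" "q \<in> formulas" "r \<in> formulas"
  shows "entails p r"
proof -
  obtain U where U: "fst p \<preceq> U" "fst q \<preceq> U" "restr U p \<le>[ctx U] restr U q"
    using assms(1) unfolding entails_def by blast
  obtain V where V: "fst q \<preceq> V" "fst r \<preceq> V" "restr V q \<le>[ctx V] restr V r"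
    using assms(2) unfolding entails_def by blast
  \<comment> \<open>The two inequalities live at unrelated contexts; concatenation supplies an
    extension of both, at which they can be chained.\<close>
  let ?W = "U @ V"
  have W: "U \<preceq> ?W" "V \<preceq> ?W"
    using U V by (auto simp: ext_def)
  interpret L: boolean_lattice "Fib P (ctx ?W)"
    using W(1) by (rule ext_fibre)
  have ext: "fst p \<preceq> ?W" "fst q \<preceq> ?W" "fst r \<preceq> ?W"
    using U V W ext_trans by blast+
  have "restr ?W p \<le>[ctx ?W] restr ?W q" "restr ?W q \<le>[ctx ?W] restr ?W r"
    using restr_mono[OF f(1,2) U(1,2) W(1) U(3)] restr_mono[OF f(2,3) V(1,2) W(2) V(3)] .
  then have "restr ?W p \<le>[ctx ?W] restr ?W r"
    using L.le_trans restr_fib[OF f(1) ext(1)] restr_fib[OF f(2) ext(2)] restr_fib[OF f(3) ext(3)]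
    by meson
  then show ?thesis
    unfolding entails_def using ext by blast
qed

lemma both_entails:
  assumes f: "p \<in> formulas" "q \<in> formulas"
  shows "entails (both p q) p" "entails (both p q) q"
proof -
  let ?U = "fst p @ fst q"
  have e: "fst p \<preceq> ?U" "fst q \<preceq> ?U" "?U \<preceq> ?U"
    using f by (auto simp: ext_def dest: formulas_ctx)
  interpret L: boolean_lattice "Fib P (ctx ?U)"
    using e(1) by (rule ext_fibre)
  have "restr ?U (both p q) \<le>[ctx ?U] restr ?U p" "restr ?U (both p q) \<le>[ctx ?U] restr ?U q"
    using restr_both[OF f e(1,2)] L.meet_left L.meet_right restr_fib f e by auto
  then show "entails (both p q) p" "entails (both p q) q"
    unfolding entails_def fst_both using e by blast+
qed

lemma entails_both:
  assumes "entails r p" "entails r q" and f: "p \<in> formulas" "q \<in> formulas" "r \<in> formulas"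
  shows "entails r (both p q)"
proof -
  obtain U where U: "fst r \<preceq> U" "fst p \<preceq> U" "restr U r \<le>[ctx U] restr U p"
    using assms(1) unfolding entails_def by blast
  obtain V where V: "fst r \<preceq> V" "fst q \<preceq> V" "restr V r \<le>[ctx V] restr V q"
    using assms(2) unfolding entails_def by blast
  let ?W = "U @ V"
  have W: "U \<preceq> ?W" "V \<preceq> ?W"
    using U V by (auto simp: ext_def)
  interpret L: boolean_lattice "Fib P (ctx ?W)"
    using W(1) by (rule ext_fibre)
  have ext: "fst p \<preceq> ?W" "fst q \<preceq> ?W" "fst r \<preceq> ?W"
    using U V W ext_trans by blast+
  have "restr ?W r \<le>[ctx ?W] restr ?W p" "restr ?W r \<le>[ctx ?W] restr ?W q"
    using restr_mono[OF f(3,1) U(1,2) W(1) U(3)] restr_mono[OF f(3,2) V(1,2) W(2) V(3)] .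
  then have "restr ?W r \<le>[ctx ?W] restr ?W (both p q)"
    using restr_both[OF f(1,2) ext(1,2)] L.meet_le restr_fib f ext by auto
  moreover have "fst (both p q) \<preceq> ?W"
    using ext by (auto simp: ext_def)
  ultimately show ?thesis
    unfolding entails_def using ext by blast
qed

text \<open>At \<open>T\<close> the two formulas have the same restriction: restricting the second
  one composes with \<open>res T T\<close>, which \<open>res S T\<close> absorbs.\<close>

lemma entails_res:
  assumes "S \<preceq> T" "\<gamma> \<in> fib (ctx S)"
  shows "entails (S, \<gamma>) (T, (res S T)\<^sup>\<star> \<gamma>)" "entails (T, (res S T)\<^sup>\<star> \<gamma>) (S, \<gamma>)"
proof -
  have T: "T \<preceq> T"
    using assms by (simp add: ext_def)
  interpret L: boolean_lattice "Fib P (ctx T)"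
    using T by (rule ext_fibre)
  have "restr T (S, \<gamma>) = restr T (T, (res S T)\<^sup>\<star> \<gamma>)"
    using reindex_comp[OF res_hom[OF assms(1)] res_hom[OF T] assms(2)] res_res[OF assms(1) T]
    by (simp add: restr_def)
  moreover have "restr T (S, \<gamma>) \<in> fib (ctx T)"
    using restr_fib[OF formulasI[OF ext_witnesses(1)[OF assms(1)] assms(2)]] assms(1) by simp
  ultimately have "restr T (S, \<gamma>) \<le>[ctx T] restr T (T, (res S T)\<^sup>\<star> \<gamma>)"
    "restr T (T, (res S T)\<^sup>\<star> \<gamma>) \<le>[ctx T] restr T (S, \<gamma>)"
    using L.le_refl by metis+
  then show "entails (S, \<gamma>) (T, (res S T)\<^sup>\<star> \<gamma>)" "entails (T, (res S T)\<^sup>\<star> \<gamma>) (S, \<gamma>)"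
    unfolding entails_def using assms(1) T by (metis fst_conv)+
qed

lemma entails_fib:
  assumes S: "set S \<subseteq> witnesses" and f: "\<gamma> \<in> fib (ctx S)" "\<delta> \<in> fib (ctx S)" and le: "\<gamma> \<le>[ctx S] \<delta>"
  shows "entails (S, \<gamma>) (S, \<delta>)"
  using reindex_mono[OF res_hom[OF ext_refl[OF S]] f le] ext_refl[OF S]
  unfolding entails_def restr_def by auto

section \<open>The generated ideal and filter in the colimit, and their disjointness\<close>

text \<open>The ideal generated in the colimit by the formulas \<open>\<beta>\<close> at their
  constants; \<open>refuted U\<close> collects finitely many of them.\<close>

definition rejected :: "(('o \<times> 'p) list \<times> 'p) set" where
  "rejected = {p \<in> formulas. \<exists>U. fst p \<preceq> U \<and> restr U p \<le>[ctx U] refuted U}"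

text \<open>The filter generated in the colimit by the instances of \<open>\<alpha>\<close> along
  arrows from contexts to \<open>X\<close>.\<close>

definition derivable :: "'o \<Rightarrow> 'p \<Rightarrow> (('o \<times> 'p) list \<times> 'p) set" where
  "derivable X \<alpha> = {p \<in> formulas. \<exists>U fs. fst p \<preceq> U \<and> set fs \<subseteq> hom (ctx U) X \<and>
     inst_meet (ctx U) \<alpha> fs \<le>[ctx U] restr U p}"

lemma rejected_mono:
  assumes p: "p \<in> formulas" and U: "fst p \<preceq> U" "restr U p \<le>[ctx U] refuted U" and UV: "U \<preceq> V"
  shows "restr V p \<le>[ctx V] refuted V"
proof -
  note w = ext_witnesses[OF UV]
  have "(res U V)\<^sup>\<star> (restr U p) \<le>[ctx V] (res U V)\<^sup>\<star> (refuted U)"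
    using reindex_mono[OF res_hom[OF UV] restr_fib[OF p U(1)] refuted_fib[OF w(1)] U(2)] .
  then have "restr V p \<le>[ctx V] (res U V)\<^sup>\<star> (refuted U)"
    by (simp add: res_restr[OF p U(1) UV])
  then show ?thesis
    using fib_le_trans[OF _ res_refuted[OF UV] ctx_Obj[OF w(2)] restr_fib[OF p ext_trans[OF U(1) UV]]
        reindex_closed[OF res_hom[OF UV] refuted_fib[OF w(1)]] refuted_fib[OF w(2)]] by blast
qed

lemma rejected_downward:
  assumes p: "p \<in> formulas" and q: "q \<in> rejected" and le: "entails p q"
  shows "p \<in> rejected"
proof -
  have qf: "q \<in> formulas"
    using q by (simp add: rejected_def)
  obtain U where U: "fst q \<preceq> U" "restr U q \<le>[ctx U] refuted U"
    using q by (auto simp: rejected_def)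
  obtain V where V: "fst p \<preceq> V" "fst q \<preceq> V" "restr V p \<le>[ctx V] restr V q"
    using le unfolding entails_def by blast
  let ?W = "U @ V"
  have W: "U \<preceq> ?W" "V \<preceq> ?W"
    using U V by (auto simp: ext_def)
  have ext: "fst p \<preceq> ?W" "fst q \<preceq> ?W"
    using V W ext_trans by blast+
  note w = ext_witnesses(2)[OF W(1)]
  have "restr ?W p \<le>[ctx ?W] refuted ?W"
    using fib_le_trans[OF restr_mono[OF p qf V(1,2) W(2) V(3)] rejected_mono[OF qf U W(1)]
        ctx_Obj[OF w] restr_fib[OF p ext(1)] restr_fib[OF qf ext(2)] refuted_fib[OF w]] .
  then show ?thesis
    unfolding rejected_def using p ext(1) by blast
qed

text \<open>The new instances are taken along the old arrows composed with
  \<open>res U V\<close>.\<close>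

lemma derivable_mono:
  assumes p: "p \<in> formulas" and U: "fst p \<preceq> U" and \<alpha>: "\<alpha> \<in> fib X" and fs: "set fs \<subseteq> hom (ctx U) X"
    and le: "inst_meet (ctx U) \<alpha> fs \<le>[ctx U] restr U p" and UV: "U \<preceq> V"
  obtains gs where "set gs \<subseteq> hom (ctx V) X" "inst_meet (ctx V) \<alpha> gs \<le>[ctx V] restr V p"
proof -
  have c: "inst_meet (ctx U) \<alpha> fs \<in> fib (ctx U)"
    using inst_meet_greatest[OF ctx_Obj[OF ext_witnesses(1)[OF UV]] \<alpha> fs] by blast
  have "(res U V)\<^sup>\<star> (inst_meet (ctx U) \<alpha> fs) \<le>[ctx V] (res U V)\<^sup>\<star> (restr U p)"
    using reindex_mono[OF res_hom[OF UV] c restr_fib[OF p U] le] .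
  then have "inst_meet (ctx V) \<alpha> (map (\<lambda>f. f \<cdot> res U V) fs) \<le>[ctx V] restr V p"
    by (simp add: inst_meet_reindex[OF res_hom[OF UV] \<alpha> fs] res_restr[OF p U UV])
  moreover have "set (map (\<lambda>f. f \<cdot> res U V) fs) \<subseteq> hom (ctx V) X"
    using fs comp_hom[OF _ res_hom[OF UV]] by auto
  ultimately show ?thesis
    using that by blast
qed

lemma derivable_upward:
  assumes \<alpha>: "\<alpha> \<in> fib X" and p: "p \<in> derivable X \<alpha>" and q: "q \<in> formulas" and le: "entails p q"
  shows "q \<in> derivable X \<alpha>"
proof -
  have pf: "p \<in> formulas"
    using p by (simp add: derivable_def)
  obtain U fs where U: "fst p \<preceq> U" "set fs \<subseteq> hom (ctx U) X" "inst_meet (ctx U) \<alpha> fs \<le>[ctx U] restr U p"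
    using p by (auto simp: derivable_def)
  obtain V where V: "fst p \<preceq> V" "fst q \<preceq> V" "restr V p \<le>[ctx V] restr V q"
    using le unfolding entails_def by blast
  let ?W = "U @ V"
  have W: "U \<preceq> ?W" "V \<preceq> ?W"
    using U V by (auto simp: ext_def)
  have ext: "fst p \<preceq> ?W" "fst q \<preceq> ?W"
    using V W ext_trans by blast+
  note w = ctx_Obj[OF ext_witnesses(2)[OF W(1)]]
  obtain gs where gs: "set gs \<subseteq> hom (ctx ?W) X" "inst_meet (ctx ?W) \<alpha> gs \<le>[ctx ?W] restr ?W p"
    using derivable_mono[OF pf U(1) \<alpha> U(2,3) W(1)] .
  have "inst_meet (ctx ?W) \<alpha> gs \<le>[ctx ?W] restr ?W q"
    using fib_le_trans[OF gs(2) restr_mono[OF pf q V(1,2) W(2) V(3)] w]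
      inst_meet_greatest[OF w \<alpha> gs(1)] restr_fib[OF pf ext(1)] restr_fib[OF q ext(2)] by blast
  then show ?thesis
    unfolding derivable_def using q ext(2) gs(1) by blast
qed

lemma derivable_both:
  assumes \<alpha>: "\<alpha> \<in> fib X" and p: "p \<in> derivable X \<alpha>" and q: "q \<in> derivable X \<alpha>"
  shows "both p q \<in> derivable X \<alpha>"
proof -
  have f: "p \<in> formulas" "q \<in> formulas"
    using p q by (simp_all add: derivable_def)
  obtain U fs where U: "fst p \<preceq> U" "set fs \<subseteq> hom (ctx U) X" "inst_meet (ctx U) \<alpha> fs \<le>[ctx U] restr U p"
    using p by (auto simp: derivable_def)
  obtain V gs where V: "fst q \<preceq> V" "set gs \<subseteq> hom (ctx V) X" "inst_meet (ctx V) \<alpha> gs \<le>[ctx V] restr V q"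
    using q by (auto simp: derivable_def)
  let ?W = "U @ V"
  have W: "U \<preceq> ?W" "V \<preceq> ?W"
    using U V by (auto simp: ext_def)
  have ext: "fst p \<preceq> ?W" "fst q \<preceq> ?W" "fst (both p q) \<preceq> ?W"
    using U V by (auto simp: ext_def)
  note w = ctx_Obj[OF ext_witnesses(2)[OF W(1)]]
  interpret L: boolean_lattice "Fib P (ctx ?W)"
    using w by (rule fibre)
  obtain fs' where fs': "set fs' \<subseteq> hom (ctx ?W) X" "inst_meet (ctx ?W) \<alpha> fs' \<le>[ctx ?W] restr ?W p"
    using derivable_mono[OF f(1) U(1) \<alpha> U(2,3) W(1)] .
  obtain gs' where gs': "set gs' \<subseteq> hom (ctx ?W) X" "inst_meet (ctx ?W) \<alpha> gs' \<le>[ctx ?W] restr ?W q"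
    using derivable_mono[OF f(2) V(1) \<alpha> V(2,3) W(2)] .
  \<comment> \<open>The meet over the concatenated list lies below the meets over both parts, hence
    below both formulas and below their meet.\<close>
  let ?hs = "fs' @ gs'"
  have hs: "set ?hs \<subseteq> hom (ctx ?W) X"
    using fs' gs' by simp
  note glb = inst_meet_greatest[OF w \<alpha>]
  note c = glb[OF fs'(1)] glb[OF gs'(1)] glb[OF hs]
  have "inst_meet (ctx ?W) \<alpha> ?hs \<le>[ctx ?W] inst_meet (ctx ?W) \<alpha> fs'"
    "inst_meet (ctx ?W) \<alpha> ?hs \<le>[ctx ?W] inst_meet (ctx ?W) \<alpha> gs'"
    using c by auto
  then have "inst_meet (ctx ?W) \<alpha> ?hs \<le>[ctx ?W] restr ?W p" "inst_meet (ctx ?W) \<alpha> ?hs \<le>[ctx ?W] restr ?W q"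
    using fib_le_trans[OF _ fs'(2) w] fib_le_trans[OF _ gs'(2) w] c
      restr_fib[OF f(1) ext(1)] restr_fib[OF f(2) ext(2)] by simp_all
  then have "inst_meet (ctx ?W) \<alpha> ?hs \<le>[ctx ?W] restr ?W (both p q)"
    unfolding restr_both[OF f ext(1,2)]
    using L.meet_le c restr_fib[OF f(1) ext(1)] restr_fib[OF f(2) ext(2)] by simp
  then show ?thesis
    unfolding derivable_def using both_formulas[OF f] ext(3) hs by blast
qed

text \<open>A common element would put a finite meet of instances of \<open>\<alpha>\<close> below
  \<open>refuted ?W\<close> at one context. That meet is then in \<open>I\<close> by downward
  closure, and the first clause of a universal ideal gives
  \<open>\<alpha> \<in> I X\<close>.\<close>

lemma derivable_rejected_disjoint:
  assumes X: "X \<in> Obj C" and \<alpha>: "\<alpha> \<in> fib X" "\<alpha> \<notin> I X"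
  shows "derivable X \<alpha> \<inter> rejected = {}"
proof (rule ccontr)
  assume "derivable X \<alpha> \<inter> rejected \<noteq> {}"
  then obtain p where p: "p \<in> derivable X \<alpha>" "p \<in> rejected"
    by blast
  have f: "p \<in> formulas"
    using p by (simp add: derivable_def)
  obtain U fs where U: "fst p \<preceq> U" "set fs \<subseteq> hom (ctx U) X" "inst_meet (ctx U) \<alpha> fs \<le>[ctx U] restr U p"
    using p by (auto simp: derivable_def)
  obtain V where V: "fst p \<preceq> V" "restr V p \<le>[ctx V] refuted V"
    using p by (auto simp: rejected_def)
  let ?W = "U @ V"
  have W: "U \<preceq> ?W" "V \<preceq> ?W"
    using U V by (auto simp: ext_def)
  note w = ext_witnesses(2)[OF W(1)]
  note wO = ctx_Obj[OF w]
  obtain gs where gs: "set gs \<subseteq> hom (ctx ?W) X" "inst_meet (ctx ?W) \<alpha> gs \<le>[ctx ?W] restr ?W p"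
    using derivable_mono[OF f U(1) \<alpha>(1) U(2,3) W(1)] .
  have c: "inst_meet (ctx ?W) \<alpha> gs \<in> fib (ctx ?W)"
    using inst_meet_greatest[OF wO \<alpha>(1) gs(1)] by blast
  have "inst_meet (ctx ?W) \<alpha> gs \<le>[ctx ?W] refuted ?W"
    using fib_le_trans[OF gs(2) rejected_mono[OF f V W(2)] wO c restr_fib[OF f ext_trans[OF U(1) W(1)]]
        refuted_fib[OF w]] .
  then have "inst_meet (ctx ?W) \<alpha> gs \<in> I (ctx ?W)"
    using ideal_downward[OF wO refuted_ideal[OF w] c] by blast
  then show False
    using ideal_inst_meet[OF \<alpha>(1) wO X gs(1)] \<alpha>(2) by blast
qed


text \<open>Distributivity in the fibre over a common context. Together with maximality this makes
  the filter prime.\<close>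

lemma rejected_both_join:
  assumes f: "x \<in> formulas" "y \<in> formulas" "(S, \<gamma>) \<in> formulas" "(S, \<delta>) \<in> formulas"
    and rej: "both x (S, \<gamma>) \<in> rejected" "both y (S, \<delta>) \<in> rejected"
  shows "both (both x y) (S, \<gamma> \<squnion>\<^bsub>Fib P (ctx S)\<^esub> \<delta>) \<in> rejected"
proof -
  obtain U where U: "fst x @ S \<preceq> U" "restr U (both x (S, \<gamma>)) \<le>[ctx U] refuted U"
    using rej(1) by (auto simp: rejected_def)
  obtain V where V: "fst y @ S \<preceq> V" "restr V (both y (S, \<delta>)) \<le>[ctx V] refuted V"
    using rej(2) by (auto simp: rejected_def)
  let ?W = "U @ V" and ?j = "\<gamma> \<squnion>\<^bsub>Fib P (ctx S)\<^esub> \<delta>"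
  have W: "U \<preceq> ?W" "V \<preceq> ?W" and ext: "fst x \<preceq> ?W" "fst y \<preceq> ?W" "S \<preceq> ?W" "(fst x @ fst y) @ S \<preceq> ?W"
    using U V by (auto simp: ext_def)
  have S: "set S \<subseteq> witnesses" and gd: "\<gamma> \<in> fib (ctx S)" "\<delta> \<in> fib (ctx S)"
    using f by (auto simp: formulas_def)
  interpret S: boolean_lattice "Fib P (ctx S)"
    by (rule fibre[OF ctx_Obj[OF S]])
  have j: "(S, ?j) \<in> formulas"
    using S gd by (intro formulasI) auto
  note w = ext_witnesses(2)[OF W(1)]
  interpret L: boolean_lattice "Fib P (ctx ?W)"
    by (rule fibre[OF ctx_Obj[OF w]])
  let ?x = "restr ?W x" and ?y = "restr ?W y" and ?g = "restr ?W (S, \<gamma>)" and ?d = "restr ?W (S, \<delta>)"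
    and ?R = "refuted ?W"
  have in_W: "?x \<in> fib (ctx ?W)" "?y \<in> fib (ctx ?W)" "?g \<in> fib (ctx ?W)" "?d \<in> fib (ctx ?W)" "?R \<in> fib (ctx ?W)"
    using f ext w by (simp_all add: restr_fib refuted_fib)
  have m: "?x \<sqinter>\<^bsub>Fib P (ctx ?W)\<^esub> ?y \<in> fib (ctx ?W)"
    using in_W by simp
  have "?x \<sqinter>\<^bsub>Fib P (ctx ?W)\<^esub> ?g \<le>[ctx ?W] ?R" "?y \<sqinter>\<^bsub>Fib P (ctx ?W)\<^esub> ?d \<le>[ctx ?W] ?R"
    using rejected_mono[OF both_formulas[OF f(1,3)] _ U(2) W(1)] U(1)
      rejected_mono[OF both_formulas[OF f(2,4)] _ V(2) W(2)] V(1)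
      restr_both[OF f(1,3) ext(1)] restr_both[OF f(2,4) ext(2)] ext(3) by simp_all
  moreover have "?x \<sqinter>\<^bsub>Fib P (ctx ?W)\<^esub> ?y \<sqinter>\<^bsub>Fib P (ctx ?W)\<^esub> ?g \<le>[ctx ?W] ?x \<sqinter>\<^bsub>Fib P (ctx ?W)\<^esub> ?g"
    using L.meet_le[OF L.le_trans[OF L.meet_left[OF m in_W(3)] L.meet_left[OF in_W(1,2)]] L.meet_right[OF m in_W(3)]]
      in_W m by simp
  moreover have "?x \<sqinter>\<^bsub>Fib P (ctx ?W)\<^esub> ?y \<sqinter>\<^bsub>Fib P (ctx ?W)\<^esub> ?d \<le>[ctx ?W] ?y \<sqinter>\<^bsub>Fib P (ctx ?W)\<^esub> ?d"
    using L.meet_le[OF L.le_trans[OF L.meet_left[OF m in_W(4)] L.meet_right[OF in_W(1,2)]] L.meet_right[OF m in_W(4)]]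
      in_W m by simp
  ultimately have "?x \<sqinter>\<^bsub>Fib P (ctx ?W)\<^esub> ?y \<sqinter>\<^bsub>Fib P (ctx ?W)\<^esub> ?g \<le>[ctx ?W] ?R"
    "?x \<sqinter>\<^bsub>Fib P (ctx ?W)\<^esub> ?y \<sqinter>\<^bsub>Fib P (ctx ?W)\<^esub> ?d \<le>[ctx ?W] ?R"
    using fib_le_trans[OF _ _ ctx_Obj[OF w]] in_W m L.meet_closed by meson+
  then have "?x \<sqinter>\<^bsub>Fib P (ctx ?W)\<^esub> ?y \<sqinter>\<^bsub>Fib P (ctx ?W)\<^esub> (?g \<squnion>\<^bsub>Fib P (ctx ?W)\<^esub> ?d) \<le>[ctx ?W] ?R"
    unfolding L.meet_join_distrib[OF m in_W(3,4)] using L.join_le in_W m by simp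
  moreover have "restr ?W (S, ?j) = ?g \<squnion>\<^bsub>Fib P (ctx ?W)\<^esub> ?d"
    using reindex_join[OF res_hom[OF ext(3)] gd] by (simp add: restr_def)
  ultimately have "restr ?W (both (both x y) (S, ?j)) \<le>[ctx ?W] ?R"
    using restr_both[OF both_formulas[OF f(1,2)] j] restr_both[OF f(1,2) ext(1,2)] ext
    by (simp add: ext_def)
  then show ?thesis
    unfolding rejected_def using both_formulas[OF both_formulas[OF f(1,2)] j] ext(4) by auto
qed

lemma var_rejected:
  assumes "k \<in> witnesses"
  shows "([k], (var [k] k)\<^sup>\<star> (snd k)) \<in> rejected"
proof -
  have k: "set [k] \<subseteq> witnesses" "k \<in> set [k]"
    using assms by simp_all
  have f: "(var [k] k)\<^sup>\<star> (snd k) \<in> fib (ctx [k])"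
    using reindex_closed[OF var_hom[OF k] witness_fib[OF assms]] .
  have "restr [k] ([k], (var [k] k)\<^sup>\<star> (snd k)) = (var [k] k)\<^sup>\<star> (snd k)"
    using reindex_comp[OF var_hom[OF k] res_hom[OF ext_refl[OF k(1)]] witness_fib[OF assms]]
      var_res[OF ext_refl[OF k(1)] k(2)] by (simp add: restr_def)
  then show ?thesis
    unfolding rejected_def using formulasI[OF k(1) f] var_le_refuted[OF k] ext_refl[OF k(1)]
    by (auto simp del: var.simps refuted.simps ctx.simps)
qed

lemma bottom_rejected:
  assumes S: "set S \<subseteq> witnesses"
  shows "(S, \<bottom>\<^bsub>Fib P (ctx S)\<^esub>) \<in> rejected"
proof -
  interpret L: boolean_lattice "Fib P (ctx S)"
    by (rule fibre[OF ctx_Obj[OF S]])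
  show ?thesis
    unfolding rejected_def
    using formulasI[OF S] reindex_bottom[OF res_hom[OF ext_refl[OF S]]] ext_refl[OF S]
      L.bottom_lower[OF refuted_fib[OF S]] by (auto simp: restr_def)
qed

lemma top_derivable:
  assumes S: "set S \<subseteq> witnesses"
  shows "(S, \<top>\<^bsub>Fib P (ctx S)\<^esub>) \<in> derivable X \<alpha>"
proof -
  interpret L: boolean_lattice "Fib P (ctx S)"
    by (rule fibre[OF ctx_Obj[OF S]])
  have "inst_meet (ctx S) \<alpha> [] \<le>[ctx S] restr S (S, \<top>\<^bsub>Fib P (ctx S)\<^esub>)"
    using reindex_top[OF res_hom[OF ext_refl[OF S]]] by (simp add: restr_def)
  moreover have "set [] \<subseteq> hom (ctx S) X"
    by simp
  ultimately show ?thesis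
    unfolding derivable_def using formulasI[OF S L.top_closed] ext_refl[OF S] by (metis (mono_tags, lifting) fst_conv mem_Collect_eq)
qed

lemma inst_derivable:
  assumes S: "set S \<subseteq> witnesses" and f: "f \<in> hom (ctx S) X" and \<alpha>: "\<alpha> \<in> fib X"
  shows "(S, f\<^sup>\<star> \<alpha>) \<in> derivable X \<alpha>"
proof -
  \<comment> \<open>Restricting \<open>(S, f\<^sup>\<star> \<alpha>)\<close> to its own context
    composes with \<open>res S S\<close>, so the witnessing instance is along this composite and not
    along \<open>f\<close>.\<close>
  let ?g = "f \<cdot> res S S"
  note r = res_hom[OF ext_refl[OF S]]
  have g: "?g \<in> hom (ctx S) X"
    using comp_hom[OF f r] .
  have "inst_meet (ctx S) \<alpha> [?g] \<le>[ctx S] ?g\<^sup>\<star> \<alpha>"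
    using inst_meet_greatest[OF ctx_Obj[OF S] \<alpha>, of "[?g]"] g by simp
  then have "inst_meet (ctx S) \<alpha> [?g] \<le>[ctx S] restr S (S, f\<^sup>\<star> \<alpha>)"
    using reindex_comp[OF f r \<alpha>] by (simp add: restr_def)
  moreover have "set [?g] \<subseteq> hom (ctx S) X"
    using g by simp
  ultimately show ?thesis
    unfolding derivable_def using formulasI[OF S reindex_closed[OF f \<alpha>]] ext_refl[OF S] by (metis (mono_tags, lifting) fst_conv mem_Collect_eq)
qed

section \<open>A prime filter of the colimit as a two-valued valuation\<close>

text \<open>\<open>H S \<gamma>\<close> is membership of \<open>(S, \<gamma>)\<close> in a filter
  that contains the instances of \<open>\<alpha>\<close> and is maximal among those disjoint from
  the rejected formulas. Primeness makes it a homomorphism to truth values on each fibre, and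
  closure under \<open>entails\<close> makes it compatible with restriction.\<close>

lemma valuation_exists:
  assumes X: "X \<in> Obj C" and \<alpha>: "\<alpha> \<in> fib X" "\<alpha> \<notin> I X"
  obtains H where
    "\<And>S \<gamma> \<delta>. \<lbrakk>set S \<subseteq> witnesses; \<gamma> \<in> fib (ctx S); \<delta> \<in> fib (ctx S)\<rbrakk> \<Longrightarrow>
      H S (\<gamma> \<sqinter>\<^bsub>Fib P (ctx S)\<^esub> \<delta>) \<longleftrightarrow> H S \<gamma> \<and> H S \<delta>"
    "\<And>S \<gamma> \<delta>. \<lbrakk>set S \<subseteq> witnesses; \<gamma> \<in> fib (ctx S); \<delta> \<in> fib (ctx S)\<rbrakk> \<Longrightarrow>
      H S (\<gamma> \<squnion>\<^bsub>Fib P (ctx S)\<^esub> \<delta>) \<longleftrightarrow> H S \<gamma> \<or> H S \<delta>"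
    "\<And>S. set S \<subseteq> witnesses \<Longrightarrow> H S \<top>\<^bsub>Fib P (ctx S)\<^esub>"
    "\<And>S. set S \<subseteq> witnesses \<Longrightarrow> \<not> H S \<bottom>\<^bsub>Fib P (ctx S)\<^esub>"
    "\<And>S T \<gamma>. \<lbrakk>S \<preceq> T; \<gamma> \<in> fib (ctx S)\<rbrakk> \<Longrightarrow> H T ((res S T)\<^sup>\<star> \<gamma>) \<longleftrightarrow> H S \<gamma>"
    "\<And>S f. \<lbrakk>set S \<subseteq> witnesses; f \<in> hom (ctx S) X\<rbrakk> \<Longrightarrow> H S (f\<^sup>\<star> \<alpha>)"
    "\<And>k. k \<in> witnesses \<Longrightarrow> \<not> H [k] ((var [k] k)\<^sup>\<star> (snd k))"
proof -
  have sub: "derivable X \<alpha> \<subseteq> formulas"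
    by (auto simp: derivable_def)
  have ne: "derivable X \<alpha> \<noteq> {}"
    using top_derivable[of "[]"] by auto
  obtain G where G: "derivable X \<alpha> \<subseteq> G" "G \<subseteq> formulas" "G \<inter> rejected = {}"
    and up: "\<And>p q. \<lbrakk>p \<in> G; q \<in> formulas; entails p q\<rbrakk> \<Longrightarrow> q \<in> G"
    and meet: "\<And>p q. \<lbrakk>p \<in> G; q \<in> G\<rbrakk> \<Longrightarrow> both p q \<in> G"
    and max: "\<And>p. \<lbrakk>p \<in> formulas; p \<notin> G\<rbrakk> \<Longrightarrow> \<exists>x\<in>G. both x p \<in> rejected"
    by (rule maximal_filter_exists[where E = formulas and le = entails and m = both, OF entails_refl
          entails_trans both_formulas both_entails entails_both sub ne derivable_upward[OF \<alpha>(1)]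
          derivable_both[OF \<alpha>(1)] rejected_downward derivable_rejected_disjoint[OF assms]])
      (assumption | rule that)+
  have mono: "(S, \<delta>) \<in> G"
    if "(S, \<gamma>) \<in> G" "set S \<subseteq> witnesses" "\<gamma> \<in> fib (ctx S)" "\<delta> \<in> fib (ctx S)" "\<gamma> \<le>[ctx S] \<delta>" for S \<gamma> \<delta>
    using up[OF that(1) formulasI entails_fib] that by blast
  show ?thesis
  proof (rule that[of "\<lambda>S \<gamma>. (S, \<gamma>) \<in> G"])
    fix S \<gamma> \<delta> assume S: "set S \<subseteq> witnesses" and gd: "\<gamma> \<in> fib (ctx S)" "\<delta> \<in> fib (ctx S)"
    interpret L: boolean_lattice "Fib P (ctx S)"
      by (rule fibre[OF ctx_Obj[OF S]])
    note f = formulasI[OF S gd(1)] formulasI[OF S gd(2)]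
    have "(S, \<gamma> \<sqinter>\<^bsub>Fib P (ctx S)\<^esub> \<delta>) \<in> G" if "(S, \<gamma>) \<in> G" "(S, \<delta>) \<in> G"
    proof -
      \<comment> \<open>\<open>both\<close> forms the meet in the doubled context
        \<open>S @ S\<close>; \<open>entails_res\<close> brings it back to \<open>S\<close>.\<close>
      have e: "S \<preceq> S @ S"
        using ext_append(1)[OF S S] .
      have "both (S, \<gamma>) (S, \<delta>) = (S @ S, (res S (S @ S))\<^sup>\<star> (\<gamma> \<sqinter>\<^bsub>Fib P (ctx S)\<^esub> \<delta>))"
        using reindex_meet[OF res_hom[OF e] gd] by (simp add: both_def Let_def restr_def)
      then have "entails (both (S, \<gamma>) (S, \<delta>)) (S, \<gamma> \<sqinter>\<^bsub>Fib P (ctx S)\<^esub> \<delta>)"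
        using entails_res(2)[OF e] gd by simp
      then show ?thesis
        using up[OF meet[OF that]] formulasI[OF S] gd by simp
    qed
    then show "(S, \<gamma> \<sqinter>\<^bsub>Fib P (ctx S)\<^esub> \<delta>) \<in> G \<longleftrightarrow> (S, \<gamma>) \<in> G \<and> (S, \<delta>) \<in> G"
      using mono[OF _ S _ _ L.meet_left[OF gd]] mono[OF _ S _ _ L.meet_right[OF gd]] gd by auto
    \<comment> \<open>If neither disjunct is in \<open>G\<close>, maximality gives \<open>x\<close>
      and \<open>y\<close> in \<open>G\<close> whose meets with the disjuncts are rejected. The meet
      of \<open>x\<close>, \<open>y\<close> and the join would then be both rejected and in
      \<open>G\<close>.\<close>
    have "(S, \<gamma> \<squnion>\<^bsub>Fib P (ctx S)\<^esub> \<delta>) \<notin> G" if no: "(S, \<gamma>) \<notin> G" "(S, \<delta>) \<notin> G"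
    proof
      assume j: "(S, \<gamma> \<squnion>\<^bsub>Fib P (ctx S)\<^esub> \<delta>) \<in> G"
      obtain x y where xy: "x \<in> G" "y \<in> G" "both x (S, \<gamma>) \<in> rejected" "both y (S, \<delta>) \<in> rejected"
        using max[OF f(1) no(1)] max[OF f(2) no(2)] by blast
      have "both (both x y) (S, \<gamma> \<squnion>\<^bsub>Fib P (ctx S)\<^esub> \<delta>) \<in> rejected"
        using rejected_both_join[OF _ _ f xy(3,4)] xy(1,2) G(2) by blast
      then show False
        using meet[OF meet[OF xy(1,2)] j] G(3) by blast
    qed
    then show "(S, \<gamma> \<squnion>\<^bsub>Fib P (ctx S)\<^esub> \<delta>) \<in> G \<longleftrightarrow> (S, \<gamma>) \<in> G \<or> (S, \<delta>) \<in> G"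
      using mono[OF _ S _ _ L.join_left[OF gd]] mono[OF _ S _ _ L.join_right[OF gd]] gd by auto
  next
    fix S assume "set S \<subseteq> witnesses"
    then show "(S, \<top>\<^bsub>Fib P (ctx S)\<^esub>) \<in> G" "(S, \<bottom>\<^bsub>Fib P (ctx S)\<^esub>) \<notin> G"
      using top_derivable bottom_rejected G by blast+
  next
    fix S T \<gamma> assume ST: "S \<preceq> T" and g: "\<gamma> \<in> fib (ctx S)"
    show "(T, (res S T)\<^sup>\<star> \<gamma>) \<in> G \<longleftrightarrow> (S, \<gamma>) \<in> G"
      using up[OF _ _ entails_res(1)[OF ST g]] up[OF _ _ entails_res(2)[OF ST g]]
        formulasI[OF ext_witnesses(1)[OF ST] g]
        formulasI[OF ext_witnesses(2)[OF ST] reindex_closed[OF res_hom[OF ST] g]] by blast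
  next
    fix S f assume "set S \<subseteq> witnesses" "f \<in> hom (ctx S) X"
    then show "(S, f\<^sup>\<star> \<alpha>) \<in> G"
      using inst_derivable[OF _ _ \<alpha>(1)] G(1) by blast
  next
    fix k assume "k \<in> witnesses"
    then show "([k], (var [k] k)\<^sup>\<star> (snd k)) \<notin> G"
      using var_rejected G(3) by blast
  qed
qed

end

section \<open>The term model\<close>

context ideal_contexts
begin

definition terms :: "(('o \<times> 'p) list \<times> 'a) set" where
  "terms = {(S, f). set S \<subseteq> witnesses \<and> f \<in> Arr C \<and> Dom C f = ctx S}"

text \<open>The identification in the colimit of the sets of arrows out of contexts: equality after
  restriction to a common extension. Terms of all sorts are treated at once.\<close>

definition term_eq :: "((('o \<times> 'p) list \<times> 'a) \<times> (('o \<times> 'p) list \<times> 'a)) set" where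
  "term_eq = {((S, f), (T, g)). (S, f) \<in> terms \<and> (T, g) \<in> terms \<and>
     (\<exists>U. S \<preceq> U \<and> T \<preceq> U \<and> f \<cdot> res S U = g \<cdot> res T U)}"

lemma termsI: "\<lbrakk>set S \<subseteq> witnesses; f \<in> hom (ctx S) Z\<rbrakk> \<Longrightarrow> (S, f) \<in> terms"
  by (simp add: terms_def Homs_def)

lemma terms_hom: "(S, f) \<in> terms \<Longrightarrow> f \<in> hom (ctx S) (Cod C f)"
  by (simp add: terms_def Homs_def)

lemma res_agree:
  assumes f: "f \<in> hom (ctx S) Z" and g: "g \<in> hom (ctx T) Z'"
    and U: "S \<preceq> U" "T \<preceq> U" "f \<cdot> res S U = g \<cdot> res T U" and UV: "U \<preceq> V"
  shows "f \<cdot> res S V = g \<cdot> res T V"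
proof -
  have "f \<cdot> res S U \<cdot> res U V = g \<cdot> res T U \<cdot> res U V"
    using U(3) by simp
  then show ?thesis
    using comp_assoc[OF f res_hom[OF U(1)] res_hom[OF UV]] comp_assoc[OF g res_hom[OF U(2)] res_hom[OF UV]]
      res_res[OF U(1) UV] res_res[OF U(2) UV] by simp
qed

lemma term_eqI:
  assumes "f \<in> hom (ctx S) Z" "g \<in> hom (ctx T) Z" "S \<preceq> U" "T \<preceq> U" "f \<cdot> res S U = g \<cdot> res T U"
  shows "((S, f), (T, g)) \<in> term_eq"
  unfolding term_eq_def using assms termsI ext_witnesses(1) by blast

text \<open>The sort survives the identification, because the two equal composites share a
  codomain.\<close>

lemma term_eqD:
  assumes "((S, f), (T, g)) \<in> term_eq" "f \<in> hom (ctx S) Z"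
  obtains U where "g \<in> hom (ctx T) Z" "S \<preceq> U" "T \<preceq> U" "f \<cdot> res S U = g \<cdot> res T U"
proof -
  obtain U where U: "S \<preceq> U" "T \<preceq> U" "f \<cdot> res S U = g \<cdot> res T U" and g: "g \<in> hom (ctx T) (Cod C g)"
    using assms(1) terms_hom unfolding term_eq_def by blast
  have "f \<cdot> res S U \<in> hom (ctx U) Z" "g \<cdot> res T U \<in> hom (ctx U) (Cod C g)"
    using comp_hom[OF assms(2) res_hom[OF U(1)]] comp_hom[OF g res_hom[OF U(2)]] .
  then have "Cod C g = Z"
    using U(3) by (simp add: Homs_def)
  then show ?thesis
    using that U g by blast
qed

lemma term_eq_equiv: "equiv terms term_eq"
proof (rule equivI)
  show "term_eq \<subseteq> terms \<times> terms"
    by (auto simp: term_eq_def)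
  show "refl_on terms term_eq"
  proof (rule refl_onI)
    fix t assume t: "t \<in> terms"
    then show "(t, t) \<in> term_eq"
      using ext_refl[of "fst t"] by (auto simp: term_eq_def terms_def)
  qed
  show "sym term_eq"
    by (rule symI) (auto simp: term_eq_def)
  show "trans term_eq"
  proof (rule transI)
    fix t u v assume "(t, u) \<in> term_eq" "(u, v) \<in> term_eq"
    moreover obtain S f where t: "t = (S, f)"
      by fastforce
    moreover obtain T g where u: "u = (T, g)"
      by fastforce
    moreover obtain R h where v: "v = (R, h)"
      by fastforce
    ultimately have tu: "((S, f), (T, g)) \<in> term_eq" and uv: "((T, g), (R, h)) \<in> term_eq"
      by simp_all
    have f: "f \<in> hom (ctx S) (Cod C f)"
      using tu terms_hom unfolding term_eq_def by blast
    obtain U where g: "g \<in> hom (ctx T) (Cod C f)" and U: "S \<preceq> U" "T \<preceq> U" "f \<cdot> res S U = g \<cdot> res T U"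
      using term_eqD[OF tu f] .
    obtain V where h: "h \<in> hom (ctx R) (Cod C f)" and V: "T \<preceq> V" "R \<preceq> V" "g \<cdot> res T V = h \<cdot> res R V"
      using term_eqD[OF uv g] .
    have W: "U \<preceq> U @ V" "V \<preceq> U @ V"
      using U V by (auto simp: ext_def)
    have "f \<cdot> res S (U @ V) = h \<cdot> res R (U @ V)"
      using res_agree[OF f g U W(1)] res_agree[OF g h V W(2)] by simp
    then show "(t, v) \<in> term_eq"
      unfolding t v using term_eqI[OF f h ext_trans[OF U(1) W(1)] ext_trans[OF V(2) W(2)]] by blast
  qed
qed

text \<open>Objects inject into arrows by identities, a witness is an object with a formula, and a
  term is a list of witnesses with an arrow. Each step stays within the infinite universe.\<close>

lemma terms_lepoll:
  assumes inf: "infinite (UNIV :: 'u set)" and Arr: "Arr C \<lesssim> (UNIV :: 'u set)"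
    and fibs: "\<And>X. X \<in> Obj C \<Longrightarrow> fib X \<lesssim> (UNIV :: 'u set)"
  shows "terms \<lesssim> (UNIV :: 'u set)"
proof -
  have "inj_on (Id C) (Obj C)" "Id C ` Obj C \<subseteq> Arr C"
    using Id_hom by (auto simp: Homs_def intro!: inj_on_inverseI[of _ "Dom C"])
  then have "Obj C \<lesssim> Arr C"
    unfolding lepoll_def by blast
  then have "Obj C \<lesssim> (UNIV :: 'u set)"
    using Arr by (rule lepoll_trans)
  then have "Obj C \<times> (UNIV :: 'u set) \<lesssim> (UNIV :: 'u set)"
    using Times_lepoll_infinite[OF inf _ lepoll_refl] by blast
  moreover have "witnesses \<lesssim> Obj C \<times> (UNIV :: 'u set)"
    unfolding witnesses_def
    by (intro Sigma_lepoll_Times lepoll_trans[OF subset_imp_lepoll[OF ideal_fib] fibs])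
  ultimately have "witnesses \<lesssim> (UNIV :: 'u set)"
    by (rule lepoll_trans[rotated])
  then have "lists witnesses \<times> Arr C \<lesssim> (UNIV :: 'u set)"
    by (intro Times_lepoll_infinite[OF inf] lists_lepoll_infinite[OF inf] Arr)
  moreover have "terms \<subseteq> lists witnesses \<times> Arr C"
    by (auto simp: terms_def)
  ultimately show ?thesis
    using subset_imp_lepoll lepoll_trans by metis
qed

end

section \<open>The product-preserving functor of terms and its satisfaction relation\<close>

locale term_model = ideal_contexts C P I
  for C :: "('o, 'a) fpcat" and P :: "('o, 'a, 'p) doctrine" and I :: "'o \<Rightarrow> 'p set" +
  fixes code :: "('o \<times> 'p) list \<times> 'a \<Rightarrow> 'u"
    and H :: "('o \<times> 'p) list \<Rightarrow> 'p \<Rightarrow> bool"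
  assumes code: "\<And>t u. \<lbrakk>t \<in> terms; u \<in> terms\<rbrakk> \<Longrightarrow> code t = code u \<longleftrightarrow> (t, u) \<in> term_eq"
    and H_meet: "\<And>S \<gamma> \<delta>. \<lbrakk>set S \<subseteq> witnesses; \<gamma> \<in> fib (ctx S); \<delta> \<in> fib (ctx S)\<rbrakk> \<Longrightarrow>
      H S (\<gamma> \<sqinter>\<^bsub>Fib P (ctx S)\<^esub> \<delta>) \<longleftrightarrow> H S \<gamma> \<and> H S \<delta>"
    and H_join: "\<And>S \<gamma> \<delta>. \<lbrakk>set S \<subseteq> witnesses; \<gamma> \<in> fib (ctx S); \<delta> \<in> fib (ctx S)\<rbrakk> \<Longrightarrow>
      H S (\<gamma> \<squnion>\<^bsub>Fib P (ctx S)\<^esub> \<delta>) \<longleftrightarrow> H S \<gamma> \<or> H S \<delta>"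
    and H_top: "\<And>S. set S \<subseteq> witnesses \<Longrightarrow> H S \<top>\<^bsub>Fib P (ctx S)\<^esub>"
    and H_bottom: "\<And>S. set S \<subseteq> witnesses \<Longrightarrow> \<not> H S \<bottom>\<^bsub>Fib P (ctx S)\<^esub>"
    and H_res: "\<And>S T \<gamma>. \<lbrakk>S \<preceq> T; \<gamma> \<in> fib (ctx S)\<rbrakk> \<Longrightarrow> H T ((res S T)\<^sup>\<star> \<gamma>) \<longleftrightarrow> H S \<gamma>"
begin

definition points :: "'o \<Rightarrow> 'u set" where
  "points Z = {code (S, f) | S f. set S \<subseteq> witnesses \<and> f \<in> hom (ctx S) Z}"

definition decode :: "'u \<Rightarrow> ('o \<times> 'p) list \<times> 'a" where
  "decode u = (SOME t. t \<in> terms \<and> code t = u)"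

definition act :: "'a \<Rightarrow> 'u \<Rightarrow> 'u" where
  "act g u = code (fst (decode u), g \<cdot> snd (decode u))"

definition sat :: "'o \<Rightarrow> 'p \<Rightarrow> 'u set" where
  "sat Z \<gamma> = {code (S, f) | S f. set S \<subseteq> witnesses \<and> f \<in> hom (ctx S) Z \<and> H S (f\<^sup>\<star> \<gamma>)}"

lemma code_eqI:
  assumes "f \<in> hom (ctx S) Z" "g \<in> hom (ctx T) Z" "S \<preceq> U" "T \<preceq> U" "f \<cdot> res S U = g \<cdot> res T U"
  shows "code (S, f) = code (T, g)"
  using term_eqI[OF assms] code unfolding term_eq_def by auto

lemma code_eqD:
  assumes "code (S, f) = code (T, g)" "f \<in> hom (ctx S) Z" "set S \<subseteq> witnesses" "(T, g) \<in> terms"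
  obtains U where "g \<in> hom (ctx T) Z" "S \<preceq> U" "T \<preceq> U" "f \<cdot> res S U = g \<cdot> res T U"
  using term_eqD[OF _ assms(2)] code[OF termsI[OF assms(3,2)] assms(4)] assms(1) by blast

lemma pointsE:
  assumes "z \<in> points Z"
  obtains S f where "z = code (S, f)" "set S \<subseteq> witnesses" "f \<in> hom (ctx S) Z"
  using assms unfolding points_def by blast

text \<open>The representative picked by \<open>decode\<close> does not matter: terms with equal
  codes agree at an extension \<open>U\<close>, and so do their composites with
  \<open>g\<close>.\<close>

lemma act_code:
  assumes S: "set S \<subseteq> witnesses" and f: "f \<in> hom (ctx S) Y" and g: "g \<in> hom Y Z"
  shows "act g (code (S, f)) = code (S, g \<cdot> f)"
proof -
  obtain T h where Th: "decode (code (S, f)) = (T, h)"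
    by fastforce
  have "decode (code (S, f)) \<in> terms \<and> code (decode (code (S, f))) = code (S, f)"
    unfolding decode_def by (rule someI[of _ "(S, f)"]) (simp add: termsI[OF S f])
  then have T: "(T, h) \<in> terms" "code (S, f) = code (T, h)"
    using Th by auto
  obtain U where h: "h \<in> hom (ctx T) Y" and U: "S \<preceq> U" "T \<preceq> U" "f \<cdot> res S U = h \<cdot> res T U"
    using code_eqD[OF T(2) f S T(1)] .
  have "g \<cdot> f \<cdot> res S U = g \<cdot> h \<cdot> res T U"
    using comp_assoc[OF g f res_hom[OF U(1)]] comp_assoc[OF g h res_hom[OF U(2)]] U(3) by simp
  then have "code (S, g \<cdot> f) = code (T, g \<cdot> h)"
    using code_eqI[OF comp_hom[OF g f] comp_hom[OF g h] U(1,2)] by blast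
  then show ?thesis
    by (simp add: act_def Th)
qed

lemma code_points: "\<lbrakk>set S \<subseteq> witnesses; f \<in> hom (ctx S) Z\<rbrakk> \<Longrightarrow> code (S, f) \<in> points Z"
  unfolding points_def by blast

text \<open>Truth does not depend on the representative: two representatives agree at some
  \<open>U\<close>, and \<open>H_res\<close> carries truth up to \<open>U\<close> along one and down
  along the other.\<close>

lemma code_sat:
  assumes S: "set S \<subseteq> witnesses" and f: "f \<in> hom (ctx S) Z" and \<gamma>: "\<gamma> \<in> fib Z"
  shows "code (S, f) \<in> sat Z \<gamma> \<longleftrightarrow> H S (f\<^sup>\<star> \<gamma>)"
proof
  assume "code (S, f) \<in> sat Z \<gamma>"
  then obtain T g where T: "code (S, f) = code (T, g)" "set T \<subseteq> witnesses" "g \<in> hom (ctx T) Z" "H T (g\<^sup>\<star> \<gamma>)"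
    unfolding sat_def by blast
  obtain U where U: "S \<preceq> U" "T \<preceq> U" "f \<cdot> res S U = g \<cdot> res T U"
    using code_eqD[OF T(1) f S termsI[OF T(2,3)]] .
  have "H U ((res T U)\<^sup>\<star> (g\<^sup>\<star> \<gamma>))"
    using H_res[OF U(2) reindex_closed[OF T(3) \<gamma>]] T(4) by simp
  then have "H U ((res S U)\<^sup>\<star> (f\<^sup>\<star> \<gamma>))"
    using reindex_comp[OF f res_hom[OF U(1)] \<gamma>] reindex_comp[OF T(3) res_hom[OF U(2)] \<gamma>] U(3) by simp
  then show "H S (f\<^sup>\<star> \<gamma>)"
    using H_res[OF U(1) reindex_closed[OF f \<gamma>]] by simp
qed (use S f in \<open>auto simp: sat_def\<close>)

lemma sat_points: "sat Z \<gamma> \<subseteq> points Z"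
  unfolding sat_def points_def by blast

lemma points_set_functor: "set_functor C points act"
  unfolding set_functor_def
proof (intro conjI ballI)
  fix X Y f assume f: "f \<in> hom X Y"
  show "act f \<in> points X \<rightarrow> points Y"
    by (auto elim!: pointsE simp: act_code[OF _ _ f] intro!: code_points comp_hom[OF f])
next
  fix X x assume "X \<in> Obj C" "x \<in> points X"
  then show "act (Id C X) x = x"
    by (auto elim!: pointsE simp: act_code[OF _ _ Id_hom] comp_Id)
next
  fix X Y Z f g x assume f: "f \<in> hom X Y" and g: "g \<in> hom Y Z" and "x \<in> points X"
  then obtain S h where h: "x = code (S, h)" "set S \<subseteq> witnesses" "h \<in> hom (ctx S) X"
    by (auto elim: pointsE)
  show "act (g \<cdot> f) x = act g (act f x)"
    using h(1) act_code[OF h(2,3) comp_hom[OF g f]] act_code[OF h(2,3) f]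
      act_code[OF h(2) comp_hom[OF f h(3)] g] comp_assoc[OF g f h(3)] by simp
qed

lemma points_terminal:
  assumes Z: "is_terminal C Z"
  shows "\<exists>!z. z \<in> points Z"
proof -
  \<comment> \<open>The empty list has a context too, which provides a point even if there are no
    witnesses.\<close>
  obtain f where "f \<in> hom (ctx []) Z"
    using terminal_arrow[OF Z ctx_Obj[of "[]"]] by auto
  then have "code ([], f) \<in> points Z"
    by (intro code_points) auto
  moreover have "x = y" if x: "x \<in> points Z" and y: "y \<in> points Z" for x y
  proof -
    obtain S f where f: "x = code (S, f)" "set S \<subseteq> witnesses" "f \<in> hom (ctx S) Z"
      using x by (rule pointsE)
    obtain T g where g: "y = code (T, g)" "set T \<subseteq> witnesses" "g \<in> hom (ctx T) Z"
      using y by (rule pointsE)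
    note U = ext_append[OF f(2) g(2)]
    have "f \<cdot> res S (S @ T) = g \<cdot> res T (S @ T)"
      using terminal_ext[OF Z comp_hom[OF f(3) res_hom[OF U(1)]] comp_hom[OF g(3) res_hom[OF U(2)]]] .
    then show ?thesis
      unfolding f(1) g(1) by (rule code_eqI[OF f(3) g(3) U])
  qed
  ultimately show ?thesis
    by blast
qed

lemma code_res:
  assumes "f \<in> hom (ctx S) Z" and ST: "S \<preceq> T"
  shows "code (T, f \<cdot> res S T) = code (S, f)"
proof -
  have T: "T \<preceq> T"
    using ST by (simp add: ext_def)
  have "f \<cdot> res S T \<cdot> res T T = f \<cdot> res S T"
    using comp_assoc[OF assms(1) res_hom[OF ST] res_hom[OF T]] res_res[OF ST T] by simp
  then show ?thesis
    by (rule code_eqI[OF comp_hom[OF assms(1) res_hom[OF ST]] assms(1) T ST])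
qed

text \<open>Directed colimits commute with binary products. Agreements of the components at
  \<open>U\<close> and at \<open>V\<close> hold jointly at \<open>U @ V\<close>; conversely, points
  given at \<open>S\<close> and at \<open>T\<close> are paired at \<open>S @ T\<close>.\<close>

lemma points_product:
  assumes Z: "is_product C X Y Z p q"
  shows "bij_betw (\<lambda>z. (act p z, act q z)) (points Z) (points X \<times> points Y)"
proof -
  have p: "p \<in> hom Z X" and q: "q \<in> hom Z Y"
    using Z by (auto simp: is_product_def)
  have "x = y" if x: "x \<in> points Z" and y: "y \<in> points Z" and eq: "act p x = act p y" "act q x = act q y" for x y
  proof -
    obtain S f where f: "x = code (S, f)" "set S \<subseteq> witnesses" "f \<in> hom (ctx S) Z"
      using x by (rule pointsE)
    obtain T g where g: "y = code (T, g)" "set T \<subseteq> witnesses" "g \<in> hom (ctx T) Z"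
      using y by (rule pointsE)
    note pf = comp_hom[OF p f(3)] and pg = comp_hom[OF p g(3)]
      and qf = comp_hom[OF q f(3)] and qg = comp_hom[OF q g(3)]
    have ep: "code (S, p \<cdot> f) = code (T, p \<cdot> g)" and eq: "code (S, q \<cdot> f) = code (T, q \<cdot> g)"
      using eq act_code[OF f(2,3)] act_code[OF g(2,3)] p q by (auto simp: f(1) g(1))
    obtain U where U: "S \<preceq> U" "T \<preceq> U" "p \<cdot> f \<cdot> res S U = p \<cdot> g \<cdot> res T U"
      using code_eqD[OF ep pf f(2) termsI[OF g(2) pg]] .
    obtain V where V: "S \<preceq> V" "T \<preceq> V" "q \<cdot> f \<cdot> res S V = q \<cdot> g \<cdot> res T V"
      using code_eqD[OF eq qf f(2) termsI[OF g(2) qg]] .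
    let ?W = "U @ V"
    have W: "U \<preceq> ?W" "V \<preceq> ?W" "S \<preceq> ?W" "T \<preceq> ?W"
      using U V by (auto simp: ext_def)
    note rS = res_hom[OF W(3)] and rT = res_hom[OF W(4)]
    have "f \<cdot> res S ?W = g \<cdot> res T ?W"
    proof (rule product_ext[OF Z comp_hom[OF f(3) rS] comp_hom[OF g(3) rT]])
      show "p \<cdot> (f \<cdot> res S ?W) = p \<cdot> (g \<cdot> res T ?W)"
        using res_agree[OF pf pg U W(1)] comp_assoc[OF p f(3) rS] comp_assoc[OF p g(3) rT] by simp
      show "q \<cdot> (f \<cdot> res S ?W) = q \<cdot> (g \<cdot> res T ?W)"
        using res_agree[OF qf qg V W(2)] comp_assoc[OF q f(3) rS] comp_assoc[OF q g(3) rT] by simp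
    qed
    then show ?thesis
      unfolding f(1) g(1) by (rule code_eqI[OF f(3) g(3) W(3,4)])
  qed
  moreover have "\<exists>z\<in>points Z. act p z = x \<and> act q z = y" if x: "x \<in> points X" and y: "y \<in> points Y" for x y
  proof -
    obtain S f where f: "x = code (S, f)" "set S \<subseteq> witnesses" "f \<in> hom (ctx S) X"
      using x by (rule pointsE)
    obtain T g where g: "y = code (T, g)" "set T \<subseteq> witnesses" "g \<in> hom (ctx T) Y"
      using y by (rule pointsE)
    note U = ext_append[OF f(2) g(2)]
    have U': "set (S @ T) \<subseteq> witnesses"
      using f g by simp
    obtain h where h: "h \<in> hom (ctx (S @ T)) Z" "p \<cdot> h = f \<cdot> res S (S @ T)" "q \<cdot> h = g \<cdot> res T (S @ T)"
      using product_arrow[OF Z comp_hom[OF f(3) res_hom[OF U(1)]] comp_hom[OF g(3) res_hom[OF U(2)]]] by blast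
    have "act p (code (S @ T, h)) = x" "act q (code (S @ T, h)) = y"
      using act_code[OF U' h(1) p] act_code[OF U' h(1) q] code_res[OF f(3) U(1)] code_res[OF g(3) U(2)]
      by (simp_all add: h f(1) g(1))
    then show ?thesis
      using code_points[OF U' h(1)] by blast
  qed
  moreover have "act p z \<in> points X" "act q z \<in> points Y" if "z \<in> points Z" for z
    using that p q points_set_functor hom_Obj unfolding set_functor_def by blast+
  ultimately show ?thesis
    unfolding bij_betw_def inj_on_def by (auto simp: image_iff) metis
qed

text \<open>At a single term \<open>(S, f)\<close>, satisfaction is \<open>H S\<close> after
  reindexing along \<open>f\<close>, a composite of homomorphisms.\<close>

lemma sat_boolean_hom:
  assumes Z: "Z \<in> Obj C"
  shows "boolean_hom (Fib P Z) (powerset_lattice (points Z)) (sat Z)"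
proof -
  interpret L: boolean_lattice "Fib P Z"
    using Z by (rule fibre)
  have sat: "code (S, f) \<in> sat Z (\<gamma> \<sqinter>\<^bsub>Fib P Z\<^esub> \<delta>) \<longleftrightarrow> code (S, f) \<in> sat Z \<gamma> \<and> code (S, f) \<in> sat Z \<delta>"
    "code (S, f) \<in> sat Z (\<gamma> \<squnion>\<^bsub>Fib P Z\<^esub> \<delta>) \<longleftrightarrow> code (S, f) \<in> sat Z \<gamma> \<or> code (S, f) \<in> sat Z \<delta>"
    if S: "set S \<subseteq> witnesses" and f: "f \<in> hom (ctx S) Z" and gd: "\<gamma> \<in> fib Z" "\<delta> \<in> fib Z" for S f \<gamma> \<delta>
    using gd H_meet[OF S reindex_closed[OF f gd(1)] reindex_closed[OF f gd(2)]]
      H_join[OF S reindex_closed[OF f gd(1)] reindex_closed[OF f gd(2)]]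
    by (simp_all add: code_sat[OF S f] reindex_meet[OF f] reindex_join[OF f])
  have "sat Z (\<gamma> \<sqinter>\<^bsub>Fib P Z\<^esub> \<delta>) = sat Z \<gamma> \<inter> sat Z \<delta>" "sat Z (\<gamma> \<squnion>\<^bsub>Fib P Z\<^esub> \<delta>) = sat Z \<gamma> \<union> sat Z \<delta>"
    if gd: "\<gamma> \<in> fib Z" "\<delta> \<in> fib Z" for \<gamma> \<delta>
  proof -
    have "z \<in> sat Z (\<gamma> \<sqinter>\<^bsub>Fib P Z\<^esub> \<delta>) \<longleftrightarrow> z \<in> sat Z \<gamma> \<inter> sat Z \<delta>"
      "z \<in> sat Z (\<gamma> \<squnion>\<^bsub>Fib P Z\<^esub> \<delta>) \<longleftrightarrow> z \<in> sat Z \<gamma> \<union> sat Z \<delta>" if "z \<in> points Z" for z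
      using that by (auto elim!: pointsE simp: sat[OF _ _ gd])
    then show "sat Z (\<gamma> \<sqinter>\<^bsub>Fib P Z\<^esub> \<delta>) = sat Z \<gamma> \<inter> sat Z \<delta>" "sat Z (\<gamma> \<squnion>\<^bsub>Fib P Z\<^esub> \<delta>) = sat Z \<gamma> \<union> sat Z \<delta>"
      using sat_points by blast+
  qed
  moreover have "sat Z \<top>\<^bsub>Fib P Z\<^esub> = points Z"
    unfolding sat_def points_def using H_top reindex_top by fastforce
  moreover have "sat Z \<bottom>\<^bsub>Fib P Z\<^esub> = {}"
    unfolding sat_def using H_bottom reindex_bottom by fastforce
  ultimately show ?thesis
    unfolding boolean_hom_def meet_pres_def join_pres_def
    using lattice_powerset_lattice L.lattice_axioms
    by (auto simp: sat_points powerset_lattice_meet powerset_lattice_join powerset_lattice_top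
        powerset_lattice_bottom dest: subsetD[OF sat_points])
qed

text \<open>At the point of a term \<open>g\<close>, both sides state that \<open>H\<close> holds of
  \<open>\<gamma>\<close> reindexed along \<open>f \<cdot> g\<close>.\<close>

lemma sat_natural:
  assumes f: "f \<in> hom X Y" and \<gamma>: "\<gamma> \<in> fib Y"
  shows "sat X (f\<^sup>\<star> \<gamma>) = {x \<in> points X. act f x \<in> sat Y \<gamma>}"
proof -
  have "x \<in> sat X (f\<^sup>\<star> \<gamma>) \<longleftrightarrow> act f x \<in> sat Y \<gamma>" if x: "x \<in> points X" for x
  proof -
    obtain S g where g: "x = code (S, g)" "set S \<subseteq> witnesses" "g \<in> hom (ctx S) X"
      using x by (rule pointsE)
    show ?thesis
      unfolding g(1) act_code[OF g(2,3) f] code_sat[OF g(2,3) reindex_closed[OF f \<gamma>]]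
        code_sat[OF g(2) comp_hom[OF f g(3)] \<gamma>] reindex_comp[OF f g(3) \<gamma>] ..
  qed
  then show ?thesis
    using sat_points by blast
qed

lemma term_model_propositional: "propositional_model C P \<lparr>Pts = points, Act = act, Sat = sat\<rparr>"
  unfolding propositional_model_def preserves_finite_products_def
  by (simp add: points_set_functor points_terminal points_product sat_boolean_hom sat_natural)

end

section \<open>Separation of a formula from a universal ideal by one model\<close>

context ideal_contexts
begin

text \<open>In the term model every point of sort \<open>X\<close> comes from an arrow out of a
  context, so \<open>\<alpha>\<close> holds there because all its instances are true; each
  \<open>\<beta>\<close> of the ideal fails at its own constant.\<close>

lemma separating_model_exists:
  assumes inf: "infinite (UNIV :: 'u set)" and Arr: "Arr C \<lesssim> (UNIV :: 'u set)"
    and fibs: "\<And>X. X \<in> Obj C \<Longrightarrow> fib X \<lesssim> (UNIV :: 'u set)"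
    and X: "X \<in> Obj C" and \<alpha>: "\<alpha> \<in> fib X" "\<alpha> \<notin> I X"
  shows "\<exists>M :: ('o, 'a, 'p, 'u) model. propositional_model C P M \<and>
    \<alpha> \<notin> ideal_of_models P {M} X \<and> (\<forall>Y\<in>Obj C. I Y \<subseteq> ideal_of_models P {M} Y)"
proof -
  obtain code :: "('o \<times> 'p) list \<times> 'a \<Rightarrow> 'u" where code: "\<forall>t\<in>terms. \<forall>u\<in>terms. code t = code u \<longleftrightarrow> (t, u) \<in> term_eq"
    using quotient_code_exists[OF term_eq_equiv terms_lepoll[OF inf Arr fibs]] by blast
  obtain H where H: "term_model C P I code H"
    and inst: "\<And>S f. \<lbrakk>set S \<subseteq> witnesses; f \<in> hom (ctx S) X\<rbrakk> \<Longrightarrow> H S (f\<^sup>\<star> \<alpha>)"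
    and wit: "\<And>k. k \<in> witnesses \<Longrightarrow> \<not> H [k] ((var [k] k)\<^sup>\<star> (snd k))"
  proof (rule valuation_exists[OF X \<alpha>], goal_cases)
    case (1 H)
    show ?case
      by (rule 1(1)[of H]) (unfold_locales, use code 1 in auto)
  qed
  interpret term_model C P I code H
    by (rule H)
  let ?M = "\<lparr>Pts = points, Act = act, Sat = sat\<rparr> :: ('o, 'a, 'p, 'u) model"
  have "x \<in> sat X \<alpha>" if "x \<in> points X" for x
    using that code_sat[OF _ _ \<alpha>(1)] inst by (auto elim!: pointsE)
  moreover have "\<exists>y\<in>points Y. y \<notin> sat Y \<beta>" if Y: "Y \<in> Obj C" and \<beta>: "\<beta> \<in> I Y" for Y \<beta>
  proof -
    let ?k = "(Y, \<beta>)"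
    have k: "?k \<in> witnesses" "set [?k] \<subseteq> witnesses"
      using Y \<beta> by (simp_all add: witnesses_def)
    \<comment> \<open>The refuting point is the constant itself, seen as a projection from its
      one-entry context.\<close>
    have v: "var [?k] ?k \<in> hom (ctx [?k]) Y"
      using var_hom[OF k(2), of ?k] by simp
    show ?thesis
      using code_points[OF k(2) v] code_sat[OF k(2) v] wit[OF k(1)] ideal_fib[OF Y] \<beta> by force
  qed
  ultimately show ?thesis
    using term_model_propositional ideal_fib
    by (intro exI[of _ ?M]) (auto simp: ideal_of_models_def subset_iff)
qed

end

section \<open>Ideals of models\<close>

context bool_doctrine
begin

text \<open>A formula lies in the family iff it fails at some point. Failing points are moved along
  \<open>Act\<close>, paired over products, and at the terminal object supplied by its unique
  point.\<close>

lemma ideal_of_model_ultraideal: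
  assumes M: "propositional_model C P M"
  shows "universal_ultraideal C P (ideal_of_models P {M})"
proof -
  let ?J = "ideal_of_models P {M}"
  have J: "\<alpha> \<in> ?J X \<longleftrightarrow> \<alpha> \<in> fib X \<and> (\<exists>x\<in>Pts M X. x \<notin> Sat M X \<alpha>)" for \<alpha> X
    by (auto simp: ideal_of_models_def)
  have hom: "boolean_hom (Fib P X) (powerset_lattice (Pts M X)) (Sat M X)" if "X \<in> Obj C" for X
    using M that by (simp add: propositional_model_def)
  have nat: "Sat M X (f\<^sup>\<star> \<alpha>) = {x \<in> Pts M X. Act M f x \<in> Sat M Y \<alpha>}"
    if "f \<in> hom X Y" "\<alpha> \<in> fib Y" for f X Y \<alpha>
    using M that hom_Obj[OF that(1)] by (simp add: propositional_model_def)
  have sat: "Sat M X \<alpha> \<subseteq> Pts M X" if "X \<in> Obj C" "\<alpha> \<in> fib X" for X \<alpha>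
    using hom[OF that(1)] that(2) by (auto simp: boolean_hom_def)
  have act: "Act M f x \<in> Pts M Y" if "f \<in> hom X Y" "x \<in> Pts M X" for f x X Y
    using M that hom_Obj[OF that(1)] unfolding propositional_model_def set_functor_def by blast
  have "\<alpha> \<in> ?J Y" if f: "f \<in> hom X Y" and \<alpha>: "\<alpha> \<in> fib Y" and J_X: "f\<^sup>\<star> \<alpha> \<in> ?J X" for f X Y \<alpha>
  proof -
    obtain x where "x \<in> Pts M X" "x \<notin> Sat M X (f\<^sup>\<star> \<alpha>)"
      using J_X by (auto simp: J)
    then show ?thesis
      using act[OF f, of x] \<alpha> by (auto simp: J nat[OF f \<alpha>])
  qed
  moreover have "lattice_filter (Fib P X) (fib X - ?J X)" if X: "X \<in> Obj C" for X
  proof -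
    interpret L: boolean_lattice "Fib P X"
      using X by (rule fibre)
    \<comment> \<open>The complement consists of the formulas true everywhere. If
      \<open>Pts M X\<close> is empty, it is the improper filter.\<close>
    have comp: "fib X - ?J X = {\<alpha> \<in> fib X. Sat M X \<alpha> = Pts M X}"
      using sat[OF X] by (auto simp: J)
    have "isotone (Fib P X) (powerset_lattice (Pts M X)) (Sat M X)"
      using hom[OF X] by (intro join_pres_isotone) (simp_all add: boolean_hom_def)
    then have mono: "Sat M X \<alpha> \<subseteq> Sat M X \<beta>" if "\<alpha> \<in> fib X" "\<beta> \<in> fib X" "\<alpha> \<le>[X] \<beta>" for \<alpha> \<beta>
      using that by (simp add: isotone_def powerset_lattice_def)
    show ?thesis
      unfolding lattice_filter_def comp
    proof (intro conjI ballI impI)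
      show "\<top>\<^bsub>Fib P X\<^esub> \<in> {\<alpha> \<in> fib X. Sat M X \<alpha> = Pts M X}"
        using hom[OF X] by (simp add: boolean_hom_def powerset_lattice_top)
    next
      fix \<alpha> \<beta> assume "\<alpha> \<in> {\<alpha> \<in> fib X. Sat M X \<alpha> = Pts M X}" "\<beta> \<in> fib X" "\<alpha> \<le>[X] \<beta>"
      then show "\<beta> \<in> {\<alpha> \<in> fib X. Sat M X \<alpha> = Pts M X}"
        using mono[of \<alpha> \<beta>] sat[OF X, of \<beta>] by simp
    next
      fix \<alpha> \<beta> assume "\<alpha> \<in> {\<alpha> \<in> fib X. Sat M X \<alpha> = Pts M X}" "\<beta> \<in> {\<alpha> \<in> fib X. Sat M X \<alpha> = Pts M X}"
      then show "\<alpha> \<sqinter>\<^bsub>Fib P X\<^esub> \<beta> \<in> {\<alpha> \<in> fib X. Sat M X \<alpha> = Pts M X}"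
        using hom[OF X] by (simp add: boolean_hom_def meet_pres_def powerset_lattice_meet)
    qed auto
  qed
  moreover have "join_closed_over_products C P ?J"
    unfolding join_closed_over_products_def
  proof (intro ballI)
    fix X Y \<alpha> \<beta> assume X: "X \<in> Obj C" and Y: "Y \<in> Obj C" and \<alpha>: "\<alpha> \<in> ?J X" and \<beta>: "\<beta> \<in> ?J Y"
    let ?Z = "Prd C X Y" and ?p = "Pr1 C X Y" and ?q = "Pr2 C X Y"
    note Z = product_Prd_homs[OF X Y]
    interpret L: boolean_lattice "Fib P ?Z"
      using Z(1) by (rule fibre)
    obtain x y where xy: "x \<in> Pts M X" "x \<notin> Sat M X \<alpha>" "y \<in> Pts M Y" "y \<notin> Sat M Y \<beta>"
      using \<alpha> \<beta> by (auto simp: J)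
    have fib: "\<alpha> \<in> fib X" "\<beta> \<in> fib Y"
      using \<alpha> \<beta> by (simp_all add: J)
    have "bij_betw (\<lambda>z. (Act M ?p z, Act M ?q z)) (Pts M ?Z) (Pts M X \<times> Pts M Y)"
      using M Prd_product[OF X Y] unfolding propositional_model_def preserves_finite_products_def by blast
    \<comment> \<open>Surjectivity of the pairing yields one point of the product at which both
      disjuncts fail.\<close>
    then have "(x, y) \<in> (\<lambda>z. (Act M ?p z, Act M ?q z)) ` Pts M ?Z"
      using xy by (simp add: bij_betw_def)
    then obtain z where z: "z \<in> Pts M ?Z" "Act M ?p z = x" "Act M ?q z = y"
      by auto
    have re: "?p\<^sup>\<star> \<alpha> \<in> fib ?Z" "?q\<^sup>\<star> \<beta> \<in> fib ?Z"
      using reindex_closed Z fib by blast+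
    have "Sat M ?Z (?p\<^sup>\<star> \<alpha> \<squnion>\<^bsub>Fib P ?Z\<^esub> ?q\<^sup>\<star> \<beta>) = Sat M ?Z (?p\<^sup>\<star> \<alpha>) \<union> Sat M ?Z (?q\<^sup>\<star> \<beta>)"
      using hom[OF Z(1)] re sat[OF Z(1)]
      by (simp add: boolean_hom_def join_pres_def powerset_lattice_join)
    then have "z \<notin> Sat M ?Z (?p\<^sup>\<star> \<alpha> \<squnion>\<^bsub>Fib P ?Z\<^esub> ?q\<^sup>\<star> \<beta>)"
      using nat[OF Z(2) fib(1)] nat[OF Z(3) fib(2)] z xy by simp
    then show "?p\<^sup>\<star> \<alpha> \<squnion>\<^bsub>Fib P ?Z\<^esub> ?q\<^sup>\<star> \<beta> \<in> ?J ?Z"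
      using z(1) re by (auto simp: J)
  qed
  moreover have "\<bottom>\<^bsub>Fib P (Trm C)\<^esub> \<in> ?J (Trm C)"
  proof -
    interpret L: boolean_lattice "Fib P (Trm C)"
      by (rule fibre[OF Trm_Obj])
    obtain z where "z \<in> Pts M (Trm C)"
      using M Trm_terminal unfolding propositional_model_def preserves_finite_products_def by blast
    moreover have "Sat M (Trm C) \<bottom>\<^bsub>Fib P (Trm C)\<^esub> = {}"
      using hom[OF Trm_Obj] by (simp add: boolean_hom_def powerset_lattice_bottom)
    ultimately show ?thesis
      using L.bottom_closed by (auto simp: J)
  qed
  moreover have "\<forall>X\<in>Obj C. ?J X \<subseteq> fib X"
    by (auto simp: J)
  ultimately show ?thesis
    unfolding universal_ultraideal_def by blast
qed

lemma ultraideal_consistent: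
  assumes "universal_ultraideal C P J"
  shows "consistent C P J"
  using assms Trm_Obj by (auto simp: universal_ultraideal_def lattice_filter_def consistent_def)

text \<open>By contraposition: if \<open>\<alpha>\<close> is outside \<open>J Y\<close>, all its
  instances lie in the complement filter over \<open>X\<close>, hence so do their finite meets,
  including the empty one. Downward closure of \<open>J\<close> is upward closure of that
  filter.\<close>

lemma ultraideal_universal_ideal:
  assumes J: "universal_ultraideal C P J"
  shows "universal_ideal C P J"
proof -
  have filter: "lattice_filter (Fib P X) (fib X - J X)" if "X \<in> Obj C" for X
    using J that by (simp add: universal_ultraideal_def)
  have re: "\<alpha> \<in> J Y" if "f \<in> hom X Y" "\<alpha> \<in> fib Y" "f\<^sup>\<star> \<alpha> \<in> J X" for f X Y \<alpha>
    using J that hom_Obj[OF that(1)] unfolding universal_ultraideal_def by blast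
  have "inst_meet X \<alpha> fs \<in> fib X - J X"
    if X: "X \<in> Obj C" and \<alpha>: "\<alpha> \<in> fib Y" "\<alpha> \<notin> J Y" and "set fs \<subseteq> hom X Y" for X Y \<alpha> fs
    using that(4)
  proof (induction fs)
    case Nil
    then show ?case
      using filter[OF X] by (simp add: lattice_filter_def)
  next
    case (Cons f fs)
    then have "f\<^sup>\<star> \<alpha> \<in> fib X - J X"
      using re \<alpha> reindex_closed by auto
    then show ?case
      using Cons filter[OF X] unfolding lattice_filter_def by simp
  qed
  then have "\<alpha> \<in> J Y" if "X \<in> Obj C" "\<alpha> \<in> fib Y" "set fs \<subseteq> hom X Y"
    "\<Sqinter>\<^bsub>Fib P X\<^esub>((\<lambda>f. f\<^sup>\<star> \<alpha>) ` set fs) \<in> J X" for X Y \<alpha> fs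
    using that inst_meet_eq_inf[OF that(1-3)] by auto
  moreover have "\<beta> \<in> J X" if "X \<in> Obj C" "\<alpha> \<in> J X" "\<beta> \<in> fib X" "\<beta> \<le>[X] \<alpha>" for X \<alpha> \<beta>
  proof (rule ccontr)
    assume "\<beta> \<notin> J X"
    then have "\<beta> \<in> fib X - J X" "\<alpha> \<in> fib X"
      using that J by (auto simp: universal_ultraideal_def)
    then show False
      using that filter[OF that(1)] unfolding lattice_filter_def by blast
  qed
  moreover have "\<forall>X\<in>Obj C. J X \<subseteq> fib X" "join_closed_over_products C P J" "\<bottom>\<^bsub>Fib P (Trm C)\<^esub> \<in> J (Trm C)"
    using J by (simp_all add: universal_ultraideal_def)
  ultimately show ?thesis
    unfolding universal_ideal_def by blast
qed

text \<open>Each clause passes to intersections. The empty family is allowed and gives all formulas,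
  so membership of joins and of bottom in the fibres is checked separately.\<close>

lemma Inter_universal_ideal:
  assumes ideals: "\<And>J. J \<in> \<J> \<Longrightarrow> universal_ideal C P J"
    and I: "\<And>X. X \<in> Obj C \<Longrightarrow> I X = {\<alpha> \<in> fib X. \<forall>J\<in>\<J>. \<alpha> \<in> J X}"
  shows "universal_ideal C P I"
proof -
  have "\<alpha> \<in> I Y"
    if "X \<in> Obj C" "Y \<in> Obj C" "\<alpha> \<in> fib Y" "set fs \<subseteq> hom X Y" "\<Sqinter>\<^bsub>Fib P X\<^esub>((\<lambda>f. f\<^sup>\<star> \<alpha>) ` set fs) \<in> I X" for X Y \<alpha> fs
    using that ideals unfolding universal_ideal_def by (auto simp: I)
  moreover have "\<beta> \<in> I X" if "X \<in> Obj C" "\<alpha> \<in> I X" "\<beta> \<in> fib X" "\<beta> \<le>[X] \<alpha>" for X \<alpha> \<beta>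
    using that ideals unfolding universal_ideal_def by (auto simp: I)
  moreover have "join_closed_over_products C P I"
    unfolding join_closed_over_products_def
  proof (intro ballI)
    fix X Y \<alpha> \<beta> assume X: "X \<in> Obj C" and Y: "Y \<in> Obj C" and \<alpha>: "\<alpha> \<in> I X" and \<beta>: "\<beta> \<in> I Y"
    note Z = product_Prd_homs[OF X Y]
    interpret L: boolean_lattice "Fib P (Prd C X Y)"
      using Z(1) by (rule fibre)
    have "(Pr1 C X Y)\<^sup>\<star> \<alpha> \<in> fib (Prd C X Y)" "(Pr2 C X Y)\<^sup>\<star> \<beta> \<in> fib (Prd C X Y)"
      using reindex_closed[OF Z(2)] reindex_closed[OF Z(3)] \<alpha> \<beta> X Y I by auto
    then show "(Pr1 C X Y)\<^sup>\<star> \<alpha> \<squnion>\<^bsub>Fib P (Prd C X Y)\<^esub> (Pr2 C X Y)\<^sup>\<star> \<beta> \<in> I (Prd C X Y)"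
      using \<alpha> \<beta> X Y Z(1) ideals
      unfolding universal_ideal_def join_closed_over_products_def by (auto simp: I)
  qed
  moreover have "\<bottom>\<^bsub>Fib P (Trm C)\<^esub> \<in> I (Trm C)"
  proof -
    interpret L: boolean_lattice "Fib P (Trm C)"
      by (rule fibre[OF Trm_Obj])
    show ?thesis
      using ideals Trm_Obj by (auto simp: I universal_ideal_def)
  qed
  moreover have "\<forall>X\<in>Obj C. I X \<subseteq> fib X"
    by (auto simp: I)
  ultimately show ?thesis
    unfolding universal_ideal_def by blast
qed

lemma ideal_of_models_eq_Inter:
  "ideal_of_models P \<M> X = {\<alpha> \<in> fib X. \<forall>J\<in>(\<lambda>M. ideal_of_models P {M}) ` \<M>. \<alpha> \<in> J X}"
  by (auto simp: ideal_of_models_def)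

end

section \<open>The equivalences, obtained from separation and intersections\<close>

theorem theoremA10:
  fixes C :: "('o, 'a) fpcat"
    and P :: "('o, 'a, 'p) doctrine"
    and I :: "'o \<Rightarrow> 'p set"
  assumes doctrine: "boolean_doctrine C P"
    and universe: "infinite (UNIV :: 'u set)"
    and small_category: "Arr C \<lesssim> (UNIV :: 'u set)"
    and small_fibres: "\<And>X. X \<in> Obj C \<Longrightarrow> carrier (Fib P X) \<lesssim> (UNIV :: 'u set)"
    and family: "\<And>X. X \<in> Obj C \<Longrightarrow> I X \<subseteq> carrier (Fib P X)"
  defines "stmt1 \<equiv> \<exists>\<M> :: ('o, 'a, 'p, 'u) model set.
             (\<forall>M\<in>\<M>. propositional_model C P M) \<and> (\<forall>X\<in>Obj C. I X = ideal_of_models P \<M> X)"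
    and "stmt1' \<equiv> \<exists>\<M> :: ('o, 'a, 'p, 'u) model set. \<M> \<noteq> {} \<and>
             (\<forall>M\<in>\<M>. propositional_model C P M) \<and> (\<forall>X\<in>Obj C. I X = ideal_of_models P \<M> X)"
    and "stmt3 \<equiv> \<forall>X\<in>Obj C.
             I X = {\<alpha> \<in> carrier (Fib P X). \<forall>J\<in>ultraideals_above C P I. \<alpha> \<in> J X}"
  shows "(stmt1 \<longleftrightarrow> universal_ideal C P I) \<and>
         (universal_ideal C P I \<longleftrightarrow> stmt3) \<and>
         (stmt1' \<longleftrightarrow> universal_ideal C P I \<and> consistent C P I) \<and>
         (universal_ideal C P I \<and> consistent C P I \<longleftrightarrow> stmt3 \<and> ultraideals_above C P I \<noteq> {})"
proof -
  interpret bool_doctrine C P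
    by unfold_locales (rule doctrine)
  \<comment> \<open>The largest class of models that can represent \<open>I\<close>: all those whose
    own ideal contains \<open>I\<close>. It serves statement (1), and its ideals are ultraideals
    above \<open>I\<close>.\<close>
  define \<M> :: "('o, 'a, 'p, 'u) model set"
    where "\<M> = {M. propositional_model C P M \<and> (\<forall>Y\<in>Obj C. I Y \<subseteq> ideal_of_models P {M} Y)}"
  have above: "ideal_of_models P {M} \<in> ultraideals_above C P I" if "M \<in> \<M>" for M
    using that ideal_of_model_ultraideal by (auto simp: \<M>_def ultraideals_above_def)
  have separate: "\<exists>M\<in>\<M>. \<alpha> \<notin> ideal_of_models P {M} X"
    if "universal_ideal C P I" "X \<in> Obj C" "\<alpha> \<in> fib X" "\<alpha> \<notin> I X" for X \<alpha>
  proof -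
    interpret ideal_contexts C P I
      by unfold_locales (rule that(1))
    show ?thesis
      using separating_model_exists[OF universe small_category small_fibres that(2-4)]
      by (auto simp: \<M>_def)
  qed
  have ideal_models: "I X = ideal_of_models P \<M> X" if "universal_ideal C P I" "X \<in> Obj C" for X
  proof -
    have "\<alpha> \<in> I X \<longleftrightarrow> (\<forall>M\<in>\<M>. \<alpha> \<in> ideal_of_models P {M} X)" if "\<alpha> \<in> fib X" for \<alpha>
      using separate[OF \<open>universal_ideal C P I\<close> \<open>X \<in> Obj C\<close> that] \<open>X \<in> Obj C\<close> by (auto simp: \<M>_def)
    then show ?thesis
      unfolding ideal_of_models_eq_Inter[of \<M>] using family[OF that(2)] by auto
  qed
  have ideal_ultra: "I X = {\<alpha> \<in> fib X. \<forall>J\<in>ultraideals_above C P I. \<alpha> \<in> J X}"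
    if "universal_ideal C P I" "X \<in> Obj C" for X
  proof
    show "I X \<subseteq> {\<alpha> \<in> fib X. \<forall>J\<in>ultraideals_above C P I. \<alpha> \<in> J X}"
      using family[OF that(2)] that(2) by (auto simp: ultraideals_above_def)
    show "{\<alpha> \<in> fib X. \<forall>J\<in>ultraideals_above C P I. \<alpha> \<in> J X} \<subseteq> I X"
      using separate[OF that] above by blast
  qed
  have models_ideal: "universal_ideal C P I"
    if "\<forall>M\<in>\<N>. propositional_model C P M" "\<forall>X\<in>Obj C. I X = ideal_of_models P \<N> X"
    for \<N> :: "('o, 'a, 'p, 'u) model set"
  proof (rule Inter_universal_ideal)
    show "universal_ideal C P J" if "J \<in> (\<lambda>M. ideal_of_models P {M}) ` \<N>" for J
      using that \<open>\<forall>M\<in>\<N>. propositional_model C P M\<close> ideal_of_model_ultraideal ultraideal_universal_ideal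
      by blast
    show "I X = {\<alpha> \<in> fib X. \<forall>J\<in>(\<lambda>M. ideal_of_models P {M}) ` \<N>. \<alpha> \<in> J X}" if "X \<in> Obj C" for X
      using that \<open>\<forall>X\<in>Obj C. I X = ideal_of_models P \<N> X\<close> ideal_of_models_eq_Inter[of \<N> X] by metis
  qed
  have one: "stmt1 \<longleftrightarrow> universal_ideal C P I"
  proof
    show "universal_ideal C P I" if stmt1
      using that models_ideal unfolding stmt1_def by blast
    show stmt1 if "universal_ideal C P I"
      unfolding stmt1_def using ideal_models[OF that] by (intro exI[of _ \<M>]) (simp add: \<M>_def)
  qed
  have three: "universal_ideal C P I \<longleftrightarrow> stmt3"
  proof
    show "universal_ideal C P I" if stmt3
    proof (rule Inter_universal_ideal)
      show "universal_ideal C P J" if "J \<in> ultraideals_above C P I" for J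
        using that ultraideal_universal_ideal by (simp add: ultraideals_above_def)
      show "I X = {\<alpha> \<in> fib X. \<forall>J\<in>ultraideals_above C P I. \<alpha> \<in> J X}" if "X \<in> Obj C" for X
        using \<open>stmt3\<close> that unfolding stmt3_def by blast
    qed
    show stmt3 if "universal_ideal C P I"
      unfolding stmt3_def using ideal_ultra[OF that] by blast
  qed
  have consistentI: "consistent C P I" if "J \<in> ultraideals_above C P I" for J
    using that ultraideal_consistent[of J] Trm_Obj by (auto simp: ultraideals_above_def consistent_def)
  \<comment> \<open>Consistency keeps the top formula of the terminal fibre out of \<open>I\<close>;
    separating it from \<open>I\<close> produces a model.\<close>
  have nonempty: "\<M> \<noteq> {}" if "universal_ideal C P I" "consistent C P I"
  proof -
    interpret L: boolean_lattice "Fib P (Trm C)"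
      by (rule fibre[OF Trm_Obj])
    show ?thesis
      using separate[OF that(1) Trm_Obj L.top_closed] that(2) by (auto simp: consistent_def)
  qed
  have one': "stmt1' \<longleftrightarrow> universal_ideal C P I \<and> consistent C P I"
  proof
    assume stmt1'
    then obtain \<N> :: "('o, 'a, 'p, 'u) model set" and M where \<N>: "M \<in> \<N>"
      "\<forall>M\<in>\<N>. propositional_model C P M" "\<forall>X\<in>Obj C. I X = ideal_of_models P \<N> X"
      unfolding stmt1'_def by blast
    \<comment> \<open>The ideal of one member contains the ideal of the whole class, which is
      \<open>I\<close>. Its ideal is thus an ultraideal above \<open>I\<close> and forces
      consistency.\<close>
    then have "M \<in> \<M>"
      by (auto simp: \<M>_def ideal_of_models_def)
    then show "universal_ideal C P I \<and> consistent C P I"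
      using models_ideal[OF \<N>(2,3)] consistentI[OF above] by blast
  next
    assume I: "universal_ideal C P I \<and> consistent C P I"
    then have "\<forall>X\<in>Obj C. I X = ideal_of_models P \<M> X" "\<M> \<noteq> {}"
      using ideal_models nonempty by blast+
    then show stmt1'
      unfolding stmt1'_def by (intro exI[of _ \<M>]) (simp add: \<M>_def)
  qed
  have "universal_ideal C P I \<and> consistent C P I \<longleftrightarrow> stmt3 \<and> ultraideals_above C P I \<noteq> {}"
    using three nonempty above consistentI by blast
  then show ?thesis
    using one three one' by blast
qed

end
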